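(* Let $n \geq 1$ and $X\subseteq \mathbb{R}^{n}$. Then $X$ is $\langle \mathbb{R},+,<,1\rangle$-definable if and only if the following three conditions all hold: (FSP) there are only finitely many $X$-singular points; (DS) every rational section of $X$ is $\langle \mathbb{R},+,<,1\rangle$-definable; (RSP) every $X$-singular point has rational components.
   Context: Definable means first-order definable without parameters: for a structure $\mathcal{M}$ with domain $D$, a relation $Y\subseteq D^m$ is $\mathcal{M}$-definable if there is a first-order formula (with equality) in the signature of $\mathcal{M}$, without parameters, defining $Y$ in $\mathcal{M}$. $\mathbb{R}^n$ carries the norm $|x|=\max_{i}|x_i|$, and $B(x,r)$ is the open ball of center $x$ and radius $r>0$. For $v\in\mathbb{R}^n\setminus\{0\}$ and $y\in\mathbb{R}^n$ let $L_v(y)=\{y+\alpha v\mid \alpha\in\mathbb{R}\}$, and for $Y\subseteq\mathbb{R}^n$ let $L_v(Y)=\bigcup_{y\in Y}L_v(y)$. A nonzero vector $v\in\mathbb{R}^n$ is an $X$-stratum at $x\in\mathbb{R}^n$ if there is a real $r>0$ with $B(x,r)\cap L_v(X\cap B(x,r))\subseteq X$; by convention the zero vector is also a stratum. The set $\mathrm{Str}_X(x)$ of $X$-strata at $x$ is a vector subspace of $\mathbb{R}^n$. The point $x$ is $X$-singular if $\mathrm{Str}_X(x)=\{0\}$. A section of $X$ is a set $X\cap H$ with $H=\mathbb{R}^{i}\times\{c\}\times\mathbb{R}^{n-i-1}$ for some $0\le i<n$ and $c\in\mathbb{R}$; it is a rational section if $c\in\mathbb{Q}$. *)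

theory Defs
  imports "HOL-Analysis.Analysis"
begin

section \<open>First-order definability in the structure \<open>(\<real>, +, <, 1)\<close>\<close>

datatype 'v trm =
    Var 'v
  | One
  | Plus "'v trm" "'v trm"

datatype 'v fml =
    Eq "'v trm" "'v trm"
  | Less "'v trm" "'v trm"
  | Neg "'v fml"
  | Conj "'v fml" "'v fml"
  | Exi 'v "'v fml"

primrec trm_val :: "('v \<Rightarrow> real) \<Rightarrow> 'v trm \<Rightarrow> real" where
  "trm_val e (Var x) = e x"
| "trm_val e One = 1"
| "trm_val e (Plus s t) = trm_val e s + trm_val e t"

primrec sat :: "('v \<Rightarrow> real) \<Rightarrow> 'v fml \<Rightarrow> bool" where
  "sat e (Eq s t) \<longleftrightarrow> trm_val e s = trm_val e t"
| "sat e (Less s t) \<longleftrightarrow> trm_val e s < trm_val e t"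
| "sat e (Neg \<phi>) \<longleftrightarrow> \<not> sat e \<phi>"
| "sat e (Conj \<phi> \<psi>) \<longleftrightarrow> sat e \<phi> \<and> sat e \<psi>"
| "sat e (Exi x \<phi>) \<longleftrightarrow> (\<exists>a. sat (e(x := a)) \<phi>)"

primrec trm_vars :: "'v trm \<Rightarrow> 'v set" where
  "trm_vars (Var x) = {x}"
| "trm_vars One = {}"
| "trm_vars (Plus s t) = trm_vars s \<union> trm_vars t"

primrec free_vars :: "'v fml \<Rightarrow> 'v set" where
  "free_vars (Eq s t) = trm_vars s \<union> trm_vars t"
| "free_vars (Less s t) = trm_vars s \<union> trm_vars t"
| "free_vars (Neg \<phi>) = free_vars \<phi>"
| "free_vars (Conj \<phi> \<psi>) = free_vars \<phi> \<union> free_vars \<psi>"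
| "free_vars (Exi x \<phi>) = free_vars \<phi> - {x}"

lemma trm_val_cong: "(\<And>x. x \<in> trm_vars t \<Longrightarrow> e x = e' x) \<Longrightarrow> trm_val e t = trm_val e' t"
  by (induction t) auto

lemma sat_cong: "(\<And>x. x \<in> free_vars \<phi> \<Longrightarrow> e x = e' x) \<Longrightarrow> sat e \<phi> = sat e' \<phi>"
proof (induction \<phi> arbitrary: e e')
  case (Exi x \<phi>)
  have "sat (e(x := a)) \<phi> = sat (e'(x := a)) \<phi>" for a
    by (rule Exi.IH) (use Exi.prems in auto)
  then show ?case by simp
next
  case (Eq s t)
  then show ?case using trm_val_cong[of s e e'] trm_val_cong[of t e e'] by simp
next
  case (Less s t)
  then show ?case using trm_val_cong[of s e e'] trm_val_cong[of t e e'] by simp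
next
  case (Neg \<phi>)
  then show ?case by (metis free_vars.simps(3) sat.simps(3))
next
  case (Conj \<phi> \<psi>)
  then show ?case by (metis UnI1 UnI2 free_vars.simps(4) sat.simps(4))
qed

text \<open>The variable \<open>Inl i\<close> stands for the \<open>i\<close>-th coordinate; the variables \<open>Inr k\<close> are an
  infinite supply of further variables, which may occur only bound. Hence the value \<open>0\<close>
  assigned to them is irrelevant (lemma \<open>sat_cong\<close>), and there are no parameters.\<close>

definition definable :: "(real ^ 'n) set \<Rightarrow> bool" where
  "definable Y \<longleftrightarrow> (\<exists>\<phi> :: ('n + nat) fml. free_vars \<phi> \<subseteq> range Inl \<and>
     Y = {x. sat (case_sum (\<lambda>i. x $ i) (\<lambda>_. 0)) \<phi>})"

section \<open>Strata, singular points and sections\<close>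

text \<open>Balls are taken in the maximum norm, \<open>infnorm\<close>, not in the Euclidean norm of
  \<open>real ^ 'n\<close> underlying \<open>ball\<close>.\<close>

definition max_ball :: "real ^ 'n \<Rightarrow> real \<Rightarrow> (real ^ 'n) set" where
  "max_ball x r = {y. infnorm (y - x) < r}"

definition line_through :: "real ^ 'n \<Rightarrow> real ^ 'n \<Rightarrow> (real ^ 'n) set" where
  "line_through v y = {y + \<alpha> *\<^sub>R v |\<alpha>. True}"

definition lines_through :: "real ^ 'n \<Rightarrow> (real ^ 'n) set \<Rightarrow> (real ^ 'n) set" where
  "lines_through v Y = (\<Union>y\<in>Y. line_through v y)"

definition stratum :: "(real ^ 'n) set \<Rightarrow> real ^ 'n \<Rightarrow> real ^ 'n \<Rightarrow> bool" where
  "stratum X x v \<longleftrightarrow> v = 0 \<or>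
     (\<exists>r>0. max_ball x r \<inter> lines_through v (X \<inter> max_ball x r) \<subseteq> X)"

definition Str :: "(real ^ 'n) set \<Rightarrow> real ^ 'n \<Rightarrow> (real ^ 'n) set" where
  "Str X x = {v. stratum X x v}"

definition singular :: "(real ^ 'n) set \<Rightarrow> real ^ 'n \<Rightarrow> bool" where
  "singular X x \<longleftrightarrow> Str X x = {0}"

definition rational_section :: "(real ^ 'n) set \<Rightarrow> (real ^ 'n) set \<Rightarrow> bool" where
  "rational_section X S \<longleftrightarrow> (\<exists>i. \<exists>c\<in>\<rat>. S = X \<inter> {x. x $ i = c})"

end

(*
  Idea. By quantifier elimination a set is definable iff membership is determined by the signs of
  finitely many rational affine forms. Call x + Str X x the leaf of x. Away from the singular points
  X is constant along leaf directions; so if there are only finitely many leaves and each is cut out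
  by rational forms, then X is locally constant, hence constant, on every cell of these forms.

  Rationality: moving x along a stratum onto two rational hyperplanes yields rational points of the
  leaf, by induction on dim (Str X x) applied to sections; the induction ends at singular points of
  definable sets, which solve rational linear systems uniquely.

  Finiteness, by induction on the dimension k of the leaf: fix finitely many rational values
  separating the coordinates of singular points. Every leaf of a nonsingular point meets, up to local
  equality, a hyperplane x $ i = c for one of these values transversally. On a cell of forms that
  determine the section and cut out the leaves of dimension below k, the transversal points of
  dimension k all lie on the same leaf.
*)

theory Submission imports Defs begin

section \<open>Elimination of quantifiers\<close>

text \<open>For the converse direction nothing is known about \<open>X\<close> itself beyond its
  singular points and its rational sections. So every nonsingular point has to be carried along a
  stratum to a rational hyperplane which that stratum crosses; there \<open>X\<close> is locally the
  product of its section and the line of the stratum. For rationality a short move suffices, because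
  the rationals are dense. For finiteness the target must be one of finitely many prescribed
  hyperplanes, possibly far away, and the move can be blocked where the stratum is lost. The way out
  is semicontinuity: a stratum at a point is still one at all nearby points, so the space of strata
  can only shrink in a limit. A blocking point therefore has a leaf of smaller dimension, which
  drives both inductions of the finiteness proof.\<close>

definition rat_vec :: "real ^ 'n \<Rightarrow> bool" where
  "rat_vec v \<longleftrightarrow> (\<forall>i. v $ i \<in> \<rat>)"

text \<open>Coordinates with respect to a Hamel basis of the reals over the rationals. They turn a
  real solution of rational equations into a rational one, and real normals of a subspace into
  rational normals.\<close>

lemma rational_coordinates:
  obtains \<pi> :: "real \<Rightarrow> real \<Rightarrow> real" where
    "\<And>b x. \<pi> b x \<in> \<rat>" "\<And>b x y. \<pi> b (x + y) = \<pi> b x + \<pi> b y"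
    "\<And>b q x. q \<in> \<rat> \<Longrightarrow> \<pi> b (q * x) = q * \<pi> b x"
    "\<And>x. finite {b. \<pi> b x \<noteq> 0}" "\<And>x. x = (\<Sum>b | \<pi> b x \<noteq> 0. \<pi> b x * b)"
proof -
  interpret Q: vector_space "\<lambda>(q::rat) (x::real). of_rat q * x"
    by unfold_locales (auto simp: algebra_simps of_rat_add of_rat_mult)
  obtain B where B: "Q.independent B" "Q.span B = UNIV"
    using Q.maximal_independent_subset[of UNIV] by (metis UNIV_I top.extremum_unique subsetI)
  let ?\<pi> = "\<lambda>b x. of_rat (Q.representation B x b) :: real"
  show thesis
  proof (rule that[of ?\<pi>])
    show "?\<pi> b (q * x) = q * ?\<pi> b x" if q: "q \<in> \<rat>" for b q x
    proof -
      obtain r where "q = of_rat r" using q unfolding Rats_def by blast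
      then show ?thesis using Q.representation_scale[OF B(1), of x r] B(2) by (simp add: of_rat_mult)
    qed
    show "x = (\<Sum>b | ?\<pi> b x \<noteq> 0. ?\<pi> b x * b)" for x
      using Q.sum_nonzero_representation_eq[OF B(1), of x] B(2) by simp
  qed (use B Q.finite_representation in \<open>auto simp: Q.representation_add of_rat_add\<close>)
qed

text \<open>Functions of the environment rather than terms: the roots used in the elimination
  require subtraction and rational coefficients, which terms do not offer.\<close>

inductive rat_affine :: "(('v \<Rightarrow> real) \<Rightarrow> real) \<Rightarrow> bool" where
  const: "q \<in> \<rat> \<Longrightarrow> rat_affine (\<lambda>e. q)"
| var: "rat_affine (\<lambda>e. e x)"
| add: "rat_affine F \<Longrightarrow> rat_affine G \<Longrightarrow> rat_affine (\<lambda>e. F e + G e)"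
| scale: "q \<in> \<rat> \<Longrightarrow> rat_affine F \<Longrightarrow> rat_affine (\<lambda>e. q * F e)"

lemma rat_affine_diff:
  assumes "rat_affine F" "rat_affine G" shows "rat_affine (\<lambda>e. F e - G e)"
  using rat_affine.add[OF assms(1) rat_affine.scale[OF _ assms(2), of "-1"]] by simp

lemma rat_affine_trm: "rat_affine (\<lambda>e. trm_val e t)"
  by (induction t) (auto intro: rat_affine.intros)

lemma rat_affine_update:
  assumes "rat_affine F"
  shows "\<exists>c\<in>\<rat>. \<forall>e a. F (e(x := a)) = c * a + F (e(x := 0))" "rat_affine (\<lambda>e. F (e(x := 0)))"
proof -
  have "(\<exists>c\<in>\<rat>. \<forall>e a. F (e(x := a)) = c * a + F (e(x := 0))) \<and> rat_affine (\<lambda>e. F (e(x := 0)))"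
    using assms
  proof induction
    case (const q)
    then show ?case by (auto intro: rat_affine.const bexI[of _ 0])
  next
    case (var y)
    show ?case
      by (cases "y = x") (auto intro: bexI[of _ 1] bexI[of _ 0] rat_affine.intros)
  next
    case (add F G)
    then obtain c d where cd: "c \<in> \<rat>" "d \<in> \<rat>" and c: "\<And>e a. F (e(x := a)) = c * a + F (e(x := 0))"
      and d: "\<And>e a. G (e(x := a)) = d * a + G (e(x := 0))" by blast
    have "F (e(x := a)) + G (e(x := a)) = (c + d) * a + (F (e(x := 0)) + G (e(x := 0)))" for e a
      using c[of e a] d[of e a] by (simp add: algebra_simps)
    with cd have "\<exists>c\<in>\<rat>. \<forall>e a. F (e(x := a)) + G (e(x := a)) = c * a + (F (e(x := 0)) + G (e(x := 0)))"
      by (blast intro: Rats_add)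
    then show ?case using add using rat_affine.add[of "\<lambda>e. F (e(x := 0))" "\<lambda>e. G (e(x := 0))"] by blast
  next
    case (scale q F)
    then obtain c where "c \<in> \<rat>" and c: "\<And>e a. F (e(x := a)) = c * a + F (e(x := 0))" by blast
    have "q * F (e(x := a)) = (q * c) * a + q * F (e(x := 0))" for e a
      using c[of e a] by (simp add: algebra_simps)
    with \<open>c \<in> \<rat>\<close> scale.hyps have "\<exists>c\<in>\<rat>. \<forall>e a. q * F (e(x := a)) = c * a + q * F (e(x := 0))"
      by (blast intro: Rats_mult)
    then show ?case using scale using rat_affine.scale[of q "\<lambda>e. F (e(x := 0))"] by blast
  qed
  then show "\<exists>c\<in>\<rat>. \<forall>e a. F (e(x := a)) = c * a + F (e(x := 0))" "rat_affine (\<lambda>e. F (e(x := 0)))"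
    by blast+
qed

text \<open>The extension step for dense linear orders without end points: \<open>a\<close> is one
  of the \<open>r i\<close> or lies in a gap between them, and the corresponding gap between the
  \<open>r' i\<close> is not empty.\<close>

lemma same_position:
  fixes r r' :: "'a \<Rightarrow> real"
  assumes fin: "finite I" and ord: "\<And>i j. i \<in> I \<Longrightarrow> j \<in> I \<Longrightarrow> sgn (r i - r j) = sgn (r' i - r' j)"
  shows "\<exists>a'. \<forall>i\<in>I. sgn (a - r i) = sgn (a' - r' i)"
proof (cases "\<exists>i\<in>I. r i = a")
  case True
  then show ?thesis using ord by blast
next
  case False
  define L U where "L = r' ` {i\<in>I. r i < a}" and "U = r' ` {i\<in>I. a < r i}"
  have LU: "l < u" if lu: "l \<in> L" "u \<in> U" for l u
  proof -
    obtain i j where "i \<in> I" "j \<in> I" "r i < r j" and "l = r' i" "u = r' j"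
      using lu by (auto simp: L_def U_def)
    then show ?thesis using ord[of i j] by (auto simp: sgn_if split: if_splits)
  qed
  have fin': "finite L" "finite U" using fin by (auto simp: L_def U_def)
  have "\<exists>a'. (\<forall>l\<in>L. l < a') \<and> (\<forall>u\<in>U. a' < u)"
  proof -
    have "\<exists>a'. (\<forall>u\<in>U. a' < u)" "\<exists>a'. (\<forall>l\<in>L. l < a')"
      using bdd_below_finite[OF fin'(2)] bdd_above_finite[OF fin'(1)]
      by (meson bdd_below_def bdd_above_def lt_ex gt_ex less_le_trans le_less_trans)+
    moreover have "\<exists>a'. (\<forall>l\<in>L. l < a') \<and> (\<forall>u\<in>U. a' < u)" if "L \<noteq> {}" "U \<noteq> {}"
    proof -
      have "Max L < Min U" using LU[of "Max L" "Min U"] that fin' by simp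
      then obtain a' where "Max L < a'" "a' < Min U" using dense by blast
      then show ?thesis using that fin' by auto
    qed
    ultimately show ?thesis by blast
  qed
  then obtain a' where a': "\<And>l. l \<in> L \<Longrightarrow> l < a'" "\<And>u. u \<in> U \<Longrightarrow> a' < u" by blast
  have "sgn (a - r i) = sgn (a' - r' i)" if "i \<in> I" for i
  proof (cases "r i < a")
    case True
    then show ?thesis using a'(1)[of "r' i"] that by (auto simp: L_def)
  next
    case F: False
    then have "a < r i" using False that by force
    then show ?thesis using a'(2)[of "r' i"] that by (auto simp: U_def)
  qed
  then show ?thesis by blast
qed

text \<open>For a quantifier over \<open>x\<close>, the forms in which \<open>x\<close> occurs are replaced by the differences of their
  roots in \<open>x\<close>: if these roots are ordered alike for \<open>e\<close> and \<open>e'\<close>, each witness for \<open>e\<close> has a counterpart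
  in the same position for \<open>e'\<close>.\<close>

lemma sat_determined_by_signs:
  "\<exists>A. finite A \<and> (\<forall>F\<in>A. rat_affine F) \<and>
     (\<forall>e e'. (\<forall>F\<in>A. sgn (F e) = sgn (F e')) \<longrightarrow> sat e \<phi> = sat e' \<phi>)"
proof (induction \<phi>)
  case (Eq s t)
  show ?case
    by (intro exI[of _ "{\<lambda>e. trm_val e s - trm_val e t}"])
       (auto intro: rat_affine_diff rat_affine_trm simp: sgn_if split: if_splits)
next
  case (Less s t)
  show ?case
    by (intro exI[of _ "{\<lambda>e. trm_val e s - trm_val e t}"])
       (auto intro: rat_affine_diff rat_affine_trm simp: sgn_if split: if_splits)
next
  case (Neg \<phi>)
  then show ?case by simp
next
  case (Conj \<phi> \<psi>)
  obtain A where A: "finite A" "\<forall>F\<in>A. rat_affine F"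
    "\<forall>e e'. (\<forall>F\<in>A. sgn (F e) = sgn (F e')) \<longrightarrow> sat e \<phi> = sat e' \<phi>"
    using Conj.IH(1) by (elim exE conjE)
  obtain B where B: "finite B" "\<forall>F\<in>B. rat_affine F"
    "\<forall>e e'. (\<forall>F\<in>B. sgn (F e) = sgn (F e')) \<longrightarrow> sat e \<psi> = sat e' \<psi>"
    using Conj.IH(2) by (elim exE conjE)
  show ?case
  proof (intro exI[of _ "A \<union> B"] conjI allI impI)
    fix e e' assume "\<forall>F\<in>A \<union> B. sgn (F e) = sgn (F e')"
    then show "sat e (Conj \<phi> \<psi>) = sat e' (Conj \<phi> \<psi>)"
      using A(3)[rule_format, of e e'] B(3)[rule_format, of e e'] by simp
  qed (use A(1,2) B(1,2) in auto)
next
  case (Exi x \<phi>)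
  obtain A where A: "finite A" "\<forall>F\<in>A. rat_affine F"
    "\<forall>e e'. (\<forall>F\<in>A. sgn (F e) = sgn (F e')) \<longrightarrow> sat e \<phi> = sat e' \<phi>"
    using Exi.IH by (elim exE conjE)
  have "\<forall>F\<in>A. \<exists>c. c \<in> \<rat> \<and> (\<forall>e a. F (e(x := a)) = c * a + F (e(x := 0)))"
    using rat_affine_update(1)[of _ x] A(2) by blast
  then obtain c where "\<forall>F\<in>A. c F \<in> \<rat> \<and> (\<forall>e a. F (e(x := a)) = c F * a + F (e(x := 0)))"
    by (rule bchoice[THEN exE])
  then have c: "\<And>F. F \<in> A \<Longrightarrow> c F \<in> \<rat>"
    "\<And>F e a. F \<in> A \<Longrightarrow> F (e(x := a)) = c F * a + F (e(x := 0))" by blast+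
  \<comment> \<open>If \<open>c F = 0\<close>, division by zero makes the root the constant 0. This
    only adds one more point to be ordered: the sign of such an \<open>F\<close> does not depend on
    \<open>x\<close> and is recorded by \<open>F (e(x := 0))\<close> in \<open>A'\<close>.\<close>
  define root where "root F e = - F (e(x := 0)) / c F" for F e
  have root: "sgn (F (e(x := a))) = sgn (c F) * sgn (a - root F e)"
    if "F \<in> A" "c F \<noteq> 0" for F e a
  proof -
    have "F (e(x := a)) = c F * (a - root F e)"
      using that by (simp add: c(2)[of F e a] root_def field_simps)
    then show ?thesis by (simp add: sgn_mult)
  qed
  have ra_root: "rat_affine (root F)" if "F \<in> A" for F
    using rat_affine.scale[OF _ rat_affine_update(2)[OF A(2)[rule_format, OF that]], of "- 1 / c F" x] c(1)[OF that]
    by (simp add: root_def[abs_def])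
  define A' where "A' = (\<lambda>F e. F (e(x := 0))) ` A \<union> (\<lambda>(F, G) e. root F e - root G e) ` (A \<times> A)"
  have half: "sat e' (Exi x \<phi>)"
    if same: "\<And>F. F \<in> A' \<Longrightarrow> sgn (F e) = sgn (F e')" and e: "sat e (Exi x \<phi>)" for e e'
  proof -
    obtain a where a: "sat (e(x := a)) \<phi>" using e by auto
    have "sgn (root F e - root G e) = sgn (root F e' - root G e')" if "F \<in> A" "G \<in> A" for F G
      using same[of "\<lambda>e. root F e - root G e"] that by (force simp: A'_def)
    then obtain a' where a': "\<And>F. F \<in> A \<Longrightarrow> sgn (a - root F e) = sgn (a' - root F e')"
      using same_position[OF A(1), of "\<lambda>F. root F e" "\<lambda>F. root F e'" a] by blast
    have "sgn (F (e(x := a))) = sgn (F (e'(x := a')))" if F: "F \<in> A" for F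
    proof (cases "c F = 0")
      case True
      then show ?thesis
        using same[of "\<lambda>e. F (e(x := 0))"] F c(2)[OF F, of e a] c(2)[OF F, of e' a']
        by (auto simp: A'_def)
    next
      case False
      then show ?thesis using root[OF F] a'[OF F] by simp
    qed
    then show ?thesis using A(3)[rule_format, of "e(x := a)" "e'(x := a')"] a by auto
  qed
  show ?case
  proof (intro exI[of _ A'] conjI allI impI)
    show "finite A'" using A(1) by (simp add: A'_def)
    show "\<forall>F\<in>A'. rat_affine F"
      using A ra_root by (auto simp: A'_def intro: rat_affine_update(2) rat_affine_diff)
    show "sat e (Exi x \<phi>) = sat e' (Exi x \<phi>)" if "\<forall>F\<in>A'. sgn (F e) = sgn (F e')" for e e'
      using half[of e e'] half[of e' e] that by fastforce
  qed
qed

text \<open>A pair \<open>(a, b)\<close> stands for the affine form \<open>x \<mapsto> a \<bullet> x + b\<close>.\<close>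

definition same_signs :: "((real ^ 'n) \<times> real) set \<Rightarrow> real ^ 'n \<Rightarrow> real ^ 'n \<Rightarrow> bool" where
  "same_signs A x y \<longleftrightarrow> (\<forall>(a, b)\<in>A. sgn (a \<bullet> x + b) = sgn (a \<bullet> y + b))"

text \<open>\<open>X\<close> is a union of cells, the classes of \<open>same_signs A\<close>. One
  implication suffices because \<open>same_signs A\<close> is symmetric.\<close>

definition determined :: "((real ^ 'n) \<times> real) set \<Rightarrow> (real ^ 'n) set \<Rightarrow> bool" where
  "determined A X \<longleftrightarrow> (\<forall>x y. same_signs A x y \<longrightarrow> x \<in> X \<longrightarrow> y \<in> X)"

definition rational_forms :: "((real ^ 'n) \<times> real) set \<Rightarrow> bool" where
  "rational_forms A \<longleftrightarrow> (\<forall>(a, b)\<in>A. rat_vec a \<and> b \<in> \<rat>)"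

abbreviation env :: "real ^ 'n \<Rightarrow> 'n + nat \<Rightarrow> real" where
  "env x \<equiv> case_sum (\<lambda>i. x $ i) (\<lambda>_. 0)"

lemma rat_affine_inner:
  assumes "rat_affine F"
  shows "\<exists>p. rat_vec (fst p) \<and> snd p \<in> \<rat> \<and>
    (\<forall>x :: real ^ 'n. F (env x) = fst p \<bullet> x + snd p)"
  using assms
proof induction
  case (const q)
  then show ?case by (intro exI[of _ "(0, q)"]) (auto simp: rat_vec_def)
next
  case (var v)
  show ?case
  proof (cases v)
    case (Inl i)
    then show ?thesis
      by (intro exI[of _ "(axis i 1, 0)"]) (auto simp: rat_vec_def cart_eq_inner_axis inner_axis_axis inner_commute)
  next
    case (Inr k)
    then show ?thesis by (intro exI[of _ "(0, 0)"]) (auto simp: rat_vec_def)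
  qed
next
  case (add F G)
  then obtain p p' where "rat_vec (fst p)" "snd p \<in> \<rat>" "rat_vec (fst p')" "snd p' \<in> \<rat>"
    "\<forall>x :: real ^ 'n. F (env x) = fst p \<bullet> x + snd p"
    "\<forall>x :: real ^ 'n. G (env x) = fst p' \<bullet> x + snd p'" by blast
  then show ?case
    by (intro exI[of _ "(fst p + fst p', snd p + snd p')"]) (auto simp: rat_vec_def inner_add_left)
next
  case (scale q F)
  then obtain p where "rat_vec (fst p)" "snd p \<in> \<rat>"
    "\<forall>x :: real ^ 'n. F (env x) = fst p \<bullet> x + snd p" by blast
  then show ?case using scale.hyps
    by (intro exI[of _ "(q *\<^sub>R fst p, q * snd p)"]) (auto simp: rat_vec_def algebra_simps)
qed

lemma definable_imp_determined:
  fixes X :: "(real ^ 'n) set"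
  assumes "definable X"
  shows "\<exists>A. finite A \<and> rational_forms A \<and> determined A X"
proof -
  from assms obtain \<phi> :: "('n + nat) fml" where X: "X = {x. sat (env x) \<phi>}"
    unfolding definable_def by blast
  obtain A where A: "finite A" "\<And>F. F \<in> A \<Longrightarrow> rat_affine F"
    "\<And>e e'. (\<forall>F\<in>A. sgn (F e) = sgn (F e')) \<Longrightarrow> sat e \<phi> = sat e' \<phi>"
    using sat_determined_by_signs[of \<phi>] by blast
  obtain p where p: "\<And>F. F \<in> A \<Longrightarrow> rat_vec (fst (p F)) \<and> snd (p F) \<in> \<rat> \<and>
      (\<forall>x :: real ^ 'n. F (env x) = fst (p F) \<bullet> x + snd (p F))"
    using rat_affine_inner[OF A(2)] by metis
  have "determined (p ` A) X"
    unfolding determined_def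
  proof (intro allI impI)
    fix x y assume s: "same_signs (p ` A) x y" and "x \<in> X"
    have "sgn (F (env x)) = sgn (F (env y))" if "F \<in> A" for F
      using s p[OF that] that by (simp add: same_signs_def case_prod_beta)
    then show "y \<in> X" using A(3)[of "env x" "env y"] \<open>x \<in> X\<close> by (simp add: X)
  qed
  moreover have "rational_forms (p ` A)" using p by (simp add: rational_forms_def case_prod_beta)
  ultimately show ?thesis using A(1) by blast
qed

section \<open>Local structure\<close>

lemma eventually_nhds_compose:
  assumes "eventually P (nhds b)" "isCont f a" "f a = b"
  shows "\<forall>\<^sub>F x in nhds a. P (f x)"
proof -
  have "filterlim f (nhds b) (nhds a)"
    using assms(2,3) by (auto simp: isCont_def tendsto_at_iff_tendsto_nhds)
  then show ?thesis using assms(1) by (rule eventually_compose_filterlim[rotated])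
qed

text \<open>This turns strata into a statement about germs on pairs of a point and a shift,
  independent of the norm and symmetric in \<open>X\<close> and its complement.\<close>

lemma Str_iff:
  "v \<in> Str X x \<longleftrightarrow> (\<forall>\<^sub>F p in nhds (x, 0::real). fst p \<in> X \<longleftrightarrow> fst p + snd p *\<^sub>R v \<in> X)"
proof (cases "v = 0")
  case True
  then show ?thesis by (simp add: Str_def stratum_def)
next
  case v: False
  show ?thesis
  proof
    assume "v \<in> Str X x"
    then obtain r where r: "r > 0" and
      sub: "max_ball x r \<inter> lines_through v (X \<inter> max_ball x r) \<subseteq> X"
      using v by (auto simp: Str_def stratum_def)
    have X: "y + t *\<^sub>R v \<in> X" if "y \<in> X" "y \<in> max_ball x r" "y + t *\<^sub>R v \<in> max_ball x r" for y t
      using that sub unfolding lines_through_def line_through_def by blast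
    have "\<forall>\<^sub>F y in nhds x. y \<in> max_ball x r"
    proof -
      have "((\<lambda>y. infnorm (y - x)) \<longlongrightarrow> infnorm (x - x)) (nhds x)"
        by (intro tendsto_infnorm tendsto_diff filterlim_ident tendsto_const)
      then show ?thesis using r by (auto simp: max_ball_def infnorm_0 intro: order_tendstoD)
    qed
    then have "\<forall>\<^sub>F p in nhds (x, 0::real). fst p \<in> max_ball x r"
        "\<forall>\<^sub>F p in nhds (x, 0::real). fst p + snd p *\<^sub>R v \<in> max_ball x r"
      by (rule eventually_nhds_compose; auto intro!: continuous_intros)+
    then show "\<forall>\<^sub>F p in nhds (x, 0::real). fst p \<in> X \<longleftrightarrow> fst p + snd p *\<^sub>R v \<in> X"
    proof eventually_elim
      case (elim p)
      then show ?case using X[of "fst p" "snd p"] X[of "fst p + snd p *\<^sub>R v" "- snd p"] by auto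
    qed
  next
    assume "\<forall>\<^sub>F p in nhds (x, 0::real). fst p \<in> X \<longleftrightarrow> fst p + snd p *\<^sub>R v \<in> X"
    then obtain e where e: "e > 0" and
      ev: "\<And>y t. dist (y, t) (x, 0) < e \<Longrightarrow> y \<in> X \<longleftrightarrow> y + t *\<^sub>R v \<in> X"
      unfolding eventually_nhds_metric by force
    define m where "m = infnorm v"
    have m: "m > 0" using v by (simp add: m_def infnorm_pos_lt)
    define d where "d = sqrt DIM(real ^ 'a)"
    \<comment> \<open>If \<open>y\<close> and \<open>y + t *\<^sub>R v\<close> lie in the max-norm
      ball of radius \<open>r\<close>, then \<open>\<bar>t\<bar> < 2 * r / m\<close>, and the
      Euclidean distance from \<open>y\<close> to \<open>x\<close> is less than
      \<open>d * r\<close>. The choice of \<open>r\<close> makes the two bounds add up to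
      \<open>e\<close>.\<close>
    define r where "r = e / (d + 2 / m)"
    have "d > 0" by (simp add: d_def)
    have r: "r > 0" using e m \<open>d > 0\<close> by (simp add: r_def add_pos_pos)
    have sum_e: "d * r + 2 * r / m = e"
    proof -
      have "d + 2 / m > 0" using m \<open>d > 0\<close> by (simp add: add_pos_pos)
      then have "(d + 2 / m) * r = e" by (simp add: r_def)
      then show ?thesis by (simp add: algebra_simps)
    qed
    have "y + t *\<^sub>R v \<in> X"
      if y: "y \<in> X" "infnorm (y - x) < r" "infnorm (y + t *\<^sub>R v - x) < r" for y t
    proof -
      have "\<bar>t\<bar> * m = infnorm ((y + t *\<^sub>R v - x) - (y - x))" by (simp add: m_def infnorm_mul)
      also have "\<dots> \<le> infnorm (y + t *\<^sub>R v - x) + infnorm (y - x)"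
        using infnorm_triangle[of "y + t *\<^sub>R v - x" "- (y - x)"] infnorm_neg[of "y - x"] by simp
      also have "\<dots> < 2 * r" using y by simp
      finally have t: "\<bar>t\<bar> < 2 * r / m" using m by (simp add: field_simps)
      have "norm (y - x) \<le> d * infnorm (y - x)" unfolding d_def by (rule norm_le_infnorm)
      also have "\<dots> < d * r" using y \<open>d > 0\<close> by simp
      finally have "norm (y - x) + \<bar>t\<bar> < e" using t sum_e by linarith
      moreover have "dist (y, t) (x, 0) \<le> norm (y - x) + \<bar>t\<bar>"
        using norm_Pair_le[of "y - x" t] by (simp add: dist_norm)
      ultimately show ?thesis using ev[of y t] y by simp
    qed
    then have "stratum X x v"
      unfolding stratum_def max_ball_def lines_through_def line_through_def using r by auto
    then show "v \<in> Str X x" by (simp add: Str_def)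
  qed
qed

text \<open>For a sum, shift by \<open>t *\<^sub>R v\<close> and then by
  \<open>t *\<^sub>R w\<close> with the same \<open>t\<close>: the intermediate point is still near
  \<open>x\<close>, where the condition on \<open>w\<close> applies.\<close>

lemma subspace_Str: "subspace (Str X x)"
proof (rule subspaceI)
  show "0 \<in> Str X x" by (simp add: Str_iff)
next
  fix v w assume v: "v \<in> Str X x" and w: "w \<in> Str X x"
  have "\<forall>\<^sub>F p in nhds (x, 0::real). fst p + snd p *\<^sub>R v \<in> X \<longleftrightarrow> fst p + snd p *\<^sub>R v + snd p *\<^sub>R w \<in> X"
    using eventually_nhds_compose[OF w[unfolded Str_iff], where f = "\<lambda>p. (fst p + snd p *\<^sub>R v, snd p)" and a = "(x, 0)"]
    by (auto intro!: continuous_intros)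
  with v[unfolded Str_iff] have
    "\<forall>\<^sub>F p in nhds (x, 0::real). fst p \<in> X \<longleftrightarrow> fst p + snd p *\<^sub>R (v + w) \<in> X"
    by eventually_elim (simp add: algebra_simps)
  then show "v + w \<in> Str X x" by (simp add: Str_iff)
next
  fix c v assume v: "v \<in> Str X x"
  show "c *\<^sub>R v \<in> Str X x"
    using eventually_nhds_compose[OF v[unfolded Str_iff], where f = "\<lambda>p. (fst p, snd p * c)" and a = "(x, 0)"]
    by (auto intro!: continuous_intros simp: Str_iff)
qed

text \<open>The translates of \<open>X\<close> by \<open>-x\<close> and by \<open>-y\<close> have
  the same germ at 0; the points \<open>x\<close> and \<open>y\<close> may be far apart.\<close>

definition loc_eq :: "'a::real_normed_vector set \<Rightarrow> 'a \<Rightarrow> 'a \<Rightarrow> bool" where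
  "loc_eq X x y \<longleftrightarrow> (\<forall>\<^sub>F u in nhds 0. x + u \<in> X \<longleftrightarrow> y + u \<in> X)"

lemma loc_eq_sym: "loc_eq X x y \<Longrightarrow> loc_eq X y x"
  unfolding loc_eq_def by (elim eventually_mono) auto

lemma loc_eq_trans: "loc_eq X x y \<Longrightarrow> loc_eq X y z \<Longrightarrow> loc_eq X x z"
  unfolding loc_eq_def by (elim eventually_rev_mp) (auto elim: eventually_mono)

lemma loc_eq_imp_mem_iff: "loc_eq X x y \<Longrightarrow> x \<in> X \<longleftrightarrow> y \<in> X"
  unfolding loc_eq_def using eventually_nhds_x_imp_x by fastforce

lemma loc_eq_near:
  assumes "loc_eq X x y"
  shows "\<forall>\<^sub>F u in nhds 0. loc_eq X (x + u) (y + u)"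
proof -
  have "\<forall>\<^sub>F w in nhds 0. \<forall>\<^sub>F u in nhds w. x + u \<in> X \<longleftrightarrow> y + u \<in> X"
    using assms by (simp add: loc_eq_def eventually_eventually)
  then show ?thesis
  proof eventually_elim
    case (elim w)
    show ?case unfolding loc_eq_def
      using eventually_nhds_compose[OF elim, where f = "\<lambda>u. w + u" and a = 0]
      by (simp add: add.assoc continuous_intros)
  qed
qed

lemma Str_loc_eq_subset:
  assumes "loc_eq X x y" shows "Str X x \<subseteq> Str X y"
proof
  fix v assume v: "v \<in> Str X x"
  have "\<forall>\<^sub>F p in nhds (y, 0::real). x + (fst p - y) \<in> X \<longleftrightarrow> x + (fst p - y) + snd p *\<^sub>R v \<in> X"
    using eventually_nhds_compose[OF v[unfolded Str_iff], where f = "\<lambda>p. (x + (fst p - y), snd p)" and a = "(y, 0)"]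
    by (auto intro!: continuous_intros)
  moreover have "\<forall>\<^sub>F p in nhds (y, 0::real). x + (fst p - y) \<in> X \<longleftrightarrow> y + (fst p - y) \<in> X"
    using eventually_nhds_compose[OF assms[unfolded loc_eq_def], where f = "\<lambda>p. fst p - y" and a = "(y, 0::real)"]
    by (auto intro!: continuous_intros)
  moreover have "\<forall>\<^sub>F p in nhds (y, 0::real). x + (fst p - y + snd p *\<^sub>R v) \<in> X \<longleftrightarrow> y + (fst p - y + snd p *\<^sub>R v) \<in> X"
    using eventually_nhds_compose[OF assms[unfolded loc_eq_def], where f = "\<lambda>p. fst p - y + snd p *\<^sub>R v" and a = "(y, 0::real)"]
    by (auto intro!: continuous_intros)
  ultimately have "\<forall>\<^sub>F p in nhds (y, 0::real). fst p \<in> X \<longleftrightarrow> fst p + snd p *\<^sub>R v \<in> X"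
    by eventually_elim (simp add: algebra_simps)
  then show "v \<in> Str X y" by (simp add: Str_iff)
qed

lemma Str_loc_eq: "loc_eq X x y \<Longrightarrow> Str X x = Str X y"
  by (meson Str_loc_eq_subset loc_eq_sym subset_antisym)

text \<open>A neighbourhood of \<open>(x, 0)\<close> on which the equivalence of
  \<open>Str_iff\<close> holds is also one of \<open>(y, 0)\<close> for \<open>y\<close> near
  \<open>x\<close>. Hence strata may be gained nearby but not lost.\<close>

lemma Str_near:
  assumes "v \<in> Str X x" shows "\<forall>\<^sub>F y in nhds x. v \<in> Str X y"
proof -
  have "\<forall>\<^sub>F q in nhds (x, 0::real). \<forall>\<^sub>F p in nhds q. fst p \<in> X \<longleftrightarrow> fst p + snd p *\<^sub>R v \<in> X"
    using assms by (simp add: Str_iff eventually_eventually)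
  from eventually_nhds_compose[OF this, where f = "\<lambda>y. (y, 0)" and a = x] show ?thesis
    by (simp add: Str_iff continuous_intros)
qed

text \<open>The equivalence of \<open>Str_iff\<close> holds on a whole neighbourhood of
  \<open>p\<close>; with \<open>snd p\<close> fixed and the base point varying, it compares the
  germs at both ends of the shift.\<close>

lemma loc_eq_along_near:
  assumes "v \<in> Str X x" shows "\<forall>\<^sub>F p in nhds (x, 0). loc_eq X (fst p) (fst p + snd p *\<^sub>R v)"
proof -
  have "\<forall>\<^sub>F q in nhds (x, 0::real). \<forall>\<^sub>F p in nhds q. fst p \<in> X \<longleftrightarrow> fst p + snd p *\<^sub>R v \<in> X"
    using assms by (simp add: Str_iff eventually_eventually)
  then show ?thesis
  proof eventually_elim
    case (elim q)
    show ?case unfolding loc_eq_def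
      using eventually_nhds_compose[OF elim, where f = "\<lambda>u. (fst q + u, snd q)" and a = 0]
      by (simp add: algebra_simps continuous_intros)
  qed
qed

text \<open>By \<open>loc_eq_along_near\<close> the classes of the equivalence relation
  \<open>loc_eq\<close> are open along the line, so a connected set of parameters meets only one of
  them.\<close>

lemma loc_eq_along_line:
  assumes "connected S" "s \<in> S" "t \<in> S" and S: "\<And>t. t \<in> S \<Longrightarrow> v \<in> Str X (x + t *\<^sub>R v)"
  shows "loc_eq X (x + s *\<^sub>R v) (x + t *\<^sub>R v)"
proof (rule connected_equivalence_relation[OF assms(1-3)])
  show "\<exists>T. openin (top_of_set S) T \<and> a \<in> T \<and> (\<forall>b\<in>T. loc_eq X (x + a *\<^sub>R v) (x + b *\<^sub>R v))"
    if "a \<in> S" for a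
  proof -
    have "\<forall>\<^sub>F b in nhds a. loc_eq X (x + a *\<^sub>R v) (x + a *\<^sub>R v + (b - a) *\<^sub>R v)"
      using eventually_nhds_compose[OF loc_eq_along_near[OF S[OF that]], where f = "\<lambda>b. (x + a *\<^sub>R v, b - a)" and a = a] by (simp add: continuous_intros)
    then obtain U where "open U" "a \<in> U" "\<And>b. b \<in> U \<Longrightarrow> loc_eq X (x + a *\<^sub>R v) (x + b *\<^sub>R v)"
      unfolding eventually_nhds by (auto simp: algebra_simps)
    then show ?thesis using that by (intro exI[of _ "S \<inter> U"]) (auto simp: openin_open_Int)
  qed
qed (blast intro: loc_eq_sym loc_eq_trans)+

text \<open>The whole affine subspace is taken, although \<open>Str X x\<close> describes
  \<open>X\<close> only near \<open>x\<close>; other points of this subspace may have other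
  leaves.\<close>

definition leaf :: "(real ^ 'n) set \<Rightarrow> real ^ 'n \<Rightarrow> (real ^ 'n) set" where
  "leaf X x = {y. y - x \<in> Str X x}"

lemma mem_leaf_self [simp]: "x \<in> leaf X x"
  using subspace_0[OF subspace_Str] by (simp add: leaf_def)

lemma leaf_eq:
  assumes "loc_eq X x y" "y - x \<in> Str X x" shows "leaf X x = leaf X y"
proof -
  have "z - x \<in> Str X x \<longleftrightarrow> z - y \<in> Str X x" for z
    using subspace_add[OF subspace_Str _ assms(2), of "z - y"]
      subspace_diff[OF subspace_Str _ assms(2), of "z - x"] by (auto simp: algebra_simps)
  then show ?thesis using Str_loc_eq[OF assms(1)] by (simp add: leaf_def)
qed

text \<open>Slide a point along \<open>u\<close> into the hyperplane, apply the stratum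
  \<open>w\<close> of the section there, and slide back. The time \<open>?s p\<close> to reach the
  hyperplane is the same before and after the shift by \<open>w\<close>, since
  \<open>w $ i = 0\<close>.\<close>

lemma Str_section_iff:
  assumes "x $ i = c" "u \<in> Str X x" "u $ i \<noteq> 0" "w $ i = 0"
  shows "w \<in> Str (X \<inter> {y. y $ i = c}) x \<longleftrightarrow> w \<in> Str X x"
proof
  assume "w \<in> Str X x"
  then show "w \<in> Str (X \<inter> {y. y $ i = c}) x"
    unfolding Str_iff by (rule eventually_mono) (auto simp: assms(4))
next
  let ?Y = "X \<inter> {y. y $ i = c}"
  let ?s = "\<lambda>p. (c - fst p $ i) / u $ i"
  assume w: "w \<in> Str ?Y x"
  have "\<forall>\<^sub>F p in nhds (x, 0::real). fst p + ?s p *\<^sub>R u \<in> ?Y \<longleftrightarrow> fst p + ?s p *\<^sub>R u + snd p *\<^sub>R w \<in> ?Y"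
    using eventually_nhds_compose[OF w[unfolded Str_iff], where f = "\<lambda>p. (fst p + ?s p *\<^sub>R u, snd p)" and a = "(x, 0::real)"]
    by (auto intro!: continuous_intros simp: assms)
  moreover have "\<forall>\<^sub>F p in nhds (x, 0::real). fst p \<in> X \<longleftrightarrow> fst p + ?s p *\<^sub>R u \<in> X"
    using eventually_nhds_compose[OF assms(2)[unfolded Str_iff], where f = "\<lambda>p. (fst p, ?s p)" and a = "(x, 0::real)"]
    by (auto intro!: continuous_intros simp: assms)
  moreover have "\<forall>\<^sub>F p in nhds (x, 0::real). fst p + snd p *\<^sub>R w \<in> X \<longleftrightarrow> fst p + snd p *\<^sub>R w + ?s p *\<^sub>R u \<in> X"
    using eventually_nhds_compose[OF assms(2)[unfolded Str_iff], where f = "\<lambda>p. (fst p + snd p *\<^sub>R w, ?s p)" and a = "(x, 0::real)"]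
    by (auto intro!: continuous_intros simp: assms)
  ultimately have "\<forall>\<^sub>F p in nhds (x, 0::real). fst p \<in> X \<longleftrightarrow> fst p + snd p *\<^sub>R w \<in> X"
  proof eventually_elim
    case (elim p)
    have "(fst p + ?s p *\<^sub>R u) $ i = c" "(fst p + ?s p *\<^sub>R u + snd p *\<^sub>R w) $ i = c"
      using assms(3,4) by simp_all
    with elim show ?case by (simp add: add_ac)
  qed
  then show "w \<in> Str X x" by (simp add: Str_iff)
qed

lemma subspace_insert_hyperplane:
  fixes W :: "(real ^ 'n) set"
  assumes "subspace W" "{w. w $ i = 0} \<subseteq> W" "u \<in> W" "u $ i \<noteq> 0"
  shows "W = UNIV"
proof -
  have "w \<in> W" for w
  proof -
    have "w - (w $ i / u $ i) *\<^sub>R u \<in> W" using assms(2,4) by auto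
    from subspace_add[OF assms(1) this subspace_scale[OF assms(1,3), of "w $ i / u $ i"]]
    show ?thesis by simp
  qed
  then show ?thesis by auto
qed

text \<open>A point of the section and its small shift along a \<open>w\<close> with
  \<open>w $ i \<noteq> 0\<close> cannot both lie in the hyperplane, so such a stratum of the
  section forces the section to be empty near \<open>x\<close>. Then all directions of the
  hyperplane, and together with \<open>u\<close> all directions, are strata of \<open>X\<close>. The
  hypothesis \<open>Str X x \<noteq> UNIV\<close> rules this out.\<close>

lemma Str_section:
  assumes "x $ i = c" "u \<in> Str X x" "u $ i \<noteq> 0" "Str X x \<noteq> UNIV"
  shows "Str (X \<inter> {y. y $ i = c}) x = Str X x \<inter> {w. w $ i = 0}"
proof -
  let ?Y = "X \<inter> {y. y $ i = c}"
  have "w $ i = 0" if w: "w \<in> Str ?Y x" for w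
  proof (rule ccontr)
    assume wi: "w $ i \<noteq> 0"
    have "\<forall>\<^sub>F y in nhds x. \<forall>\<^sub>F t in nhds (0::real). y \<in> ?Y \<longleftrightarrow> y + t *\<^sub>R w \<in> ?Y"
      using w unfolding Str_iff nhds_prod eventually_prod_filter by (auto elim!: eventually_mono)
    then have empty: "\<forall>\<^sub>F y in nhds x. y \<notin> ?Y"
    proof eventually_elim
      case (elim y)
      obtain e where "e > 0" and e: "\<And>t. \<bar>t\<bar> < e \<Longrightarrow> y \<in> ?Y \<longleftrightarrow> y + t *\<^sub>R w \<in> ?Y"
        using elim unfolding eventually_nhds_metric by (auto simp: dist_real_def)
      then show ?case using e[of "e / 2"] wi by auto
    qed
    have "w' \<in> Str X x" if "w' $ i = 0" for w'
    proof -
      have "\<forall>\<^sub>F p in nhds (x, 0::real). fst p \<notin> ?Y" "\<forall>\<^sub>F p in nhds (x, 0::real). fst p + snd p *\<^sub>R w' \<notin> ?Y"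
        by (rule eventually_nhds_compose[OF empty]; auto intro!: continuous_intros)+
      then have "w' \<in> Str ?Y x" unfolding Str_iff by eventually_elim blast
      then show ?thesis using Str_section_iff[OF assms(1-3) that] by blast
    qed
    then show False
      using subspace_insert_hyperplane[OF subspace_Str _ assms(2,3)] assms(4) by blast
  qed
  then show ?thesis using Str_section_iff[OF assms(1-3)] by blast
qed

section \<open>Definability by signs of rational forms\<close>

lemma same_signs_iff:
  "same_signs A x y \<longleftrightarrow> (\<forall>a b. (a, b) \<in> A \<longrightarrow> sgn (a \<bullet> x + b) = sgn (a \<bullet> y + b))"
  by (auto simp: same_signs_def)

text \<open>A convex combination of two numbers of equal sign has that sign; so cells are
  convex.\<close>

lemma same_signs_segment:
  assumes "same_signs A x y" "0 \<le> t" "t \<le> 1"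
  shows "same_signs A x (x + t *\<^sub>R (y - x))"
  unfolding same_signs_iff
proof (intro allI impI)
  fix a b assume "(a, b) \<in> A"
  define p q where "p = a \<bullet> x + b" and "q = a \<bullet> y + b"
  have "sgn p = sgn q" using assms(1) \<open>(a, b) \<in> A\<close> by (auto simp: same_signs_iff p_def q_def)
  moreover have pq: "a \<bullet> (x + t *\<^sub>R (y - x)) + b = (1 - t) * p + t * q"
    by (simp add: p_def q_def inner_add_right inner_diff_right algebra_simps)
  moreover have "(1 - t) * p + t * q > 0" if "p > 0" "q > 0"
    using convex_bound_lt[of "-p" 0 "-q" "1 - t" t] that assms by simp
  moreover have "(1 - t) * p + t * q < 0" if "p < 0" "q < 0"
    using convex_bound_lt[of p 0 q "1 - t" t] that assms by simp
  ultimately show "sgn (a \<bullet> x + b) = sgn (a \<bullet> (x + t *\<^sub>R (y - x)) + b)"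
    unfolding pq p_def[symmetric] by (cases "p = 0"; cases "p > 0"; cases "q = 0"; cases "q > 0") (auto simp: sgn_if split: if_splits)
qed

text \<open>On \<open>Z\<close> the function \<open>g\<close> factors through the sign vector of a
  point, and there are at most \<open>3 ^ card A\<close> sign vectors. Applied to cells, singular
  points and leaves.\<close>

lemma finite_image_by_signs:
  fixes A :: "((real ^ 'n) \<times> real) set"
  assumes "finite A" and eq: "\<And>x y. x \<in> Z \<Longrightarrow> y \<in> Z \<Longrightarrow> same_signs A x y \<Longrightarrow> g x = g y"
  shows "finite (g ` Z)"
proof -
  define \<sigma> where "\<sigma> x = restrict (\<lambda>(a, b). sgn (a \<bullet> x + b)) A" for x :: "real ^ 'n"
  have "\<sigma> ` Z \<subseteq> (\<Pi>\<^sub>E f\<in>A. {-1, 0, 1})" 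
  proof (intro image_subsetI PiE_I)
    show "\<sigma> x f \<in> {-1, 0, 1}" if "f \<in> A" for x f
      using that by (cases f) (simp add: \<sigma>_def sgn_real_def)
  qed (simp add: \<sigma>_def)
  then have fin: "finite (\<sigma> ` Z)" by (rule finite_subset) (simp add: assms(1) finite_PiE)
  have "g x = g y" if "x \<in> Z" "y \<in> Z" "\<sigma> x = \<sigma> y" for x y
  proof (rule eq[OF that(1,2)])
    show "same_signs A x y" unfolding same_signs_iff
    proof (intro allI impI)
      fix a b assume "(a, b) \<in> A"
      then show "sgn (a \<bullet> x + b) = sgn (a \<bullet> y + b)" using fun_cong[OF that(3), of "(a, b)"] by (simp add: \<sigma>_def)
    qed
  qed
  then have "g ` Z = (\<lambda>s. g (SOME x. x \<in> Z \<and> \<sigma> x = s)) ` \<sigma> ` Z"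
    unfolding image_image by (intro image_cong refl) (metis (mono_tags, lifting) someI_ex)
  then show ?thesis using fin by simp
qed

text \<open>Every affine form with rational coefficients has a positive multiple that is a difference
  of two terms; the language has no symbol for subtraction or for \<open>0\<close>.\<close>

definition term_diff :: "(real ^ 'n \<Rightarrow> real) \<Rightarrow> bool" where
  "term_diff F \<longleftrightarrow> (\<exists>s t N. N > (0::nat) \<and> trm_vars s \<union> trm_vars t \<subseteq> range Inl \<and>
     (\<forall>x. real N * F x = trm_val (env x) s - trm_val (env x) t))"

lemma term_diffE:
  assumes "term_diff F"
  obtains s t N where "N > (0::nat)" "trm_vars s \<union> trm_vars t \<subseteq> range Inl"
    "\<And>x. real N * F x = trm_val (env x) s - trm_val (env x) t"
proof -
  from assms obtain s t N where "N > (0::nat) \<and> trm_vars s \<union> trm_vars t \<subseteq> range Inl \<and>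
     (\<forall>x. real N * F x = trm_val (env x) s - trm_val (env x) t)"
    unfolding term_diff_def by (elim exE)
  then show thesis using that by blast
qed

text \<open>The factor is a successor because no term has the value 0 in every environment.\<close>

lemma term_multiple: "\<exists>t'. trm_vars t' = trm_vars t \<and> (\<forall>e. trm_val e t' = Suc n * trm_val e t)"
proof (induction n)
  case (Suc n)
  then obtain t' where "trm_vars t' = trm_vars t" "\<forall>e. trm_val e t' = Suc n * trm_val e t" by blast
  then show ?case by (intro exI[of _ "Plus t t'"]) (auto simp: algebra_simps)
qed (auto intro: exI[of _ t])

lemma term_diff_add:
  assumes "term_diff F" "term_diff G" shows "term_diff (\<lambda>x. F x + G x)"
proof -
  obtain s t M where st: "M > 0" "trm_vars s \<union> trm_vars t \<subseteq> range Inl"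
    "\<And>x. real M * F x = trm_val (env x) s - trm_val (env x) t"
    using assms(1) by (rule term_diffE) blast
  obtain u v N where uv: "N > 0" "trm_vars u \<union> trm_vars v \<subseteq> range Inl"
    "\<And>x. real N * G x = trm_val (env x) u - trm_val (env x) v"
    using assms(2) by (rule term_diffE) blast
  have mult: "\<exists>t' :: ('a + nat) trm. trm_vars t' = trm_vars t \<and> (\<forall>e. trm_val e t' = real n * trm_val e t)"
    if "n > 0" for n and t :: "('a + nat) trm"
    using term_multiple[of t "n - 1"] that by simp
  obtain s' where s': "trm_vars s' = trm_vars s" "\<And>e. trm_val e s' = N * trm_val e s"
    using mult[OF uv(1), of s] by blast
  obtain t' where t': "trm_vars t' = trm_vars t" "\<And>e. trm_val e t' = N * trm_val e t"
    using mult[OF uv(1), of t] by blast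
  obtain u' where u': "trm_vars u' = trm_vars u" "\<And>e. trm_val e u' = M * trm_val e u"
    using mult[OF st(1), of u] by blast
  obtain v' where v': "trm_vars v' = trm_vars v" "\<And>e. trm_val e v' = M * trm_val e v"
    using mult[OF st(1), of v] by blast
  have sum: "real (M * N) * (F x + G x) = real N * (real M * F x) + real M * (real N * G x)" for x
    by (simp add: algebra_simps)
  show ?thesis unfolding term_diff_def
  proof (intro exI conjI allI)
    show "M * N > 0" using st(1) uv(1) by simp
    show "trm_vars (Plus s' u') \<union> trm_vars (Plus t' v') \<subseteq> range Inl"
      using st(2) uv(2) s'(1) t'(1) u'(1) v'(1) by auto
    show "real (M * N) * (F x + G x) = trm_val (env x) (Plus s' u') -
        trm_val (env x) (Plus t' v')" for x
      unfolding sum st(3) uv(3) by (simp add: s' t' u' v' algebra_simps)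
  qed
qed

text \<open>The missing 0 on the right is replaced by \<open>One\<close>, added on both
  sides.\<close>

lemma term_diff_coordinate: "term_diff (\<lambda>x. x $ i)"
  unfolding term_diff_def
  by (intro exI[of _ "Plus (Var (Inl i)) One"] exI[of _ One] exI[of _ 1]) auto

lemma term_diff_one: "term_diff (\<lambda>x. 1)"
  unfolding term_diff_def by (intro exI[of _ "Plus One One"] exI[of _ One] exI[of _ 1]) auto

lemma term_diff_zero: "term_diff (\<lambda>x. 0)"
  unfolding term_diff_def by (intro exI[of _ One] exI[of _ 1]) auto

lemma term_diff_minus:
  assumes "term_diff F" shows "term_diff (\<lambda>x. - F x)"
proof -
  obtain s t N where "N > 0" "trm_vars s \<union> trm_vars t \<subseteq> range Inl"
    "\<And>x. real N * F x = trm_val (env x) s - trm_val (env x) t"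
    using assms(1) by (rule term_diffE) blast
  then show ?thesis unfolding term_diff_def by (intro exI[of _ t] exI[of _ s] exI[of _ N]) auto
qed

lemma term_diff_of_nat: "term_diff F \<Longrightarrow> term_diff (\<lambda>x. of_nat n * F x)"
  by (induction n) (auto simp: algebra_simps intro: term_diff_add term_diff_zero)

lemma term_diff_divide:
  assumes "term_diff F" "n > 0" shows "term_diff (\<lambda>x. F x / of_nat n)"
proof -
  obtain s t M where st: "M > 0" "trm_vars s \<union> trm_vars t \<subseteq> range Inl"
    "\<And>x. real M * F x = trm_val (env x) s - trm_val (env x) t"
    using assms(1) by (rule term_diffE) blast
  have "real (M * n) * (F x / real n) = real M * F x" for x using assms(2) by simp
  then show ?thesis unfolding term_diff_def using st assms(2)
    by (intro exI[of _ s] exI[of _ t] exI[of _ "M * n"]) auto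
qed

lemma term_diff_scale:
  assumes "term_diff F" "q \<in> \<rat>" shows "term_diff (\<lambda>x. q * F x)"
proof -
  obtain m n where mn: "n \<noteq> 0" "\<bar>q\<bar> = real m / real n" using Rats_abs_nat_div_natE[OF assms(2)] by metis
  have "term_diff (\<lambda>x. \<bar>q\<bar> * F x)"
    using term_diff_divide[OF term_diff_of_nat[OF assms(1)], of n m] mn by simp
  then show ?thesis using term_diff_minus[of "\<lambda>x. \<bar>q\<bar> * F x"] by (cases "q \<ge> 0") auto
qed

lemma term_diff_sum:
  assumes "finite I" "\<And>i. i \<in> I \<Longrightarrow> term_diff (F i)" shows "term_diff (\<lambda>x. \<Sum>i\<in>I. F i x)"
  using assms by (induction I rule: finite_induct) (auto intro: term_diff_add term_diff_zero)

lemma term_diff_form: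
  assumes "rat_vec a" "b \<in> \<rat>" shows "term_diff (\<lambda>x. a \<bullet> x + b)"
proof -
  have "term_diff (\<lambda>x. b * 1)" using term_diff_scale[OF term_diff_one assms(2)] .
  moreover have "term_diff (\<lambda>x. \<Sum>i\<in>UNIV. a $ i * x $ i)"
    using assms(1) by (intro term_diff_sum term_diff_scale term_diff_coordinate) (auto simp: rat_vec_def)
  ultimately show ?thesis
    using term_diff_add[of "\<lambda>x. \<Sum>i\<in>UNIV. a $ i * x $ i" "\<lambda>x. b * 1"] by (simp add: inner_vec_def)
qed

section \<open>Boolean combinations and the definability of cells\<close>

lemma definable_Compl: "definable X \<Longrightarrow> definable (- X)"
  unfolding definable_def
  by (elim exE conjE) (rule exI[of _ "Neg _"], auto)

lemma definable_Int:
  assumes "definable X" "definable Y" shows "definable (X \<inter> Y)"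
proof -
  obtain \<phi> \<psi> :: "('a + nat) fml" where "free_vars \<phi> \<subseteq> range Inl" "X = {x. sat (env x) \<phi>}"
    "free_vars \<psi> \<subseteq> range Inl" "Y = {x. sat (env x) \<psi>}"
    using assms unfolding definable_def by blast
  then show ?thesis unfolding definable_def by (intro exI[of _ "Conj \<phi> \<psi>"]) auto
qed

lemma definable_Un: "definable X \<Longrightarrow> definable Y \<Longrightarrow> definable (X \<union> Y)"
  using definable_Compl[OF definable_Int[OF definable_Compl definable_Compl], of X Y] by simp

lemma definable_UNIV: "definable UNIV"
  unfolding definable_def by (intro exI[of _ "Eq One One"]) auto

lemma definable_Inter:
  assumes "finite \<F>" "\<And>X. X \<in> \<F> \<Longrightarrow> definable X" shows "definable (\<Inter>\<F>)"
  using assms by (induction \<F> rule: finite_induct) (auto intro: definable_Int definable_UNIV)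

lemma definable_Union:
  assumes "finite \<F>" "\<And>X. X \<in> \<F> \<Longrightarrow> definable X" shows "definable (\<Union>\<F>)"
  using assms definable_Compl[OF definable_UNIV]
  by (induction \<F> rule: finite_induct) (auto intro: definable_Un)

lemma definable_form_pos:
  assumes "term_diff F" shows "definable {x. F x > 0}"
proof -
  obtain s t N where st: "N > 0" "trm_vars s \<union> trm_vars t \<subseteq> range Inl"
    "\<And>x. real N * F x = trm_val (env x) s - trm_val (env x) t"
    using assms(1) by (rule term_diffE) blast
  have "F x > 0 \<longleftrightarrow> real N * F x > 0" for x using st(1) by (simp add: zero_less_mult_iff)
  then show ?thesis unfolding definable_def using st
    by (intro exI[of _ "Less t s"]) auto
qed

lemma definable_form_sgn:
  assumes "rat_vec a" "b \<in> \<rat>" shows "definable {x. sgn (a \<bullet> x + b) = s}"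
proof -
  let ?F = "\<lambda>x. a \<bullet> x + b"
  have pos: "definable {x. ?F x > 0}" by (rule definable_form_pos[OF term_diff_form[OF assms]])
  have neg: "definable {x. - ?F x > 0}"
    by (rule definable_form_pos[OF term_diff_minus[OF term_diff_form[OF assms]]])
  have zero: "definable (- ({x. ?F x > 0} \<union> {x. - ?F x > 0}))"
    by (intro definable_Compl definable_Un pos neg)
  consider "s = 1" | "s = -1" | "s = 0" | "s \<notin> {1, -1, 0}" by blast
  then show ?thesis
  proof cases
    case 1
    then have "{x. sgn (?F x) = s} = {x. ?F x > 0}" by (auto simp: sgn_if split: if_splits)
    then show ?thesis using pos by simp
  next
    case 2
    then have "{x. sgn (?F x) = s} = {x. - ?F x > 0}" by (auto simp: sgn_if split: if_splits)
    then show ?thesis using neg by simp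
  next
    case 3
    then have "{x. sgn (?F x) = s} = - ({x. ?F x > 0} \<union> {x. - ?F x > 0})"
      by (auto simp: sgn_if split: if_splits)
    then show ?thesis using zero by simp
  next
    case 4
    then have "{x. sgn (?F x) = s} = - UNIV" by (auto simp: sgn_if split: if_splits)
    then show ?thesis using definable_Compl[OF definable_UNIV] by simp
  qed
qed

text \<open>\<open>X\<close> is the union of the cells of its points, and there are only finitely
  many cells.\<close>

lemma determined_imp_definable:
  fixes X :: "(real ^ 'n) set"
  assumes "finite A" "rational_forms A" "determined A X"
  shows "definable X"
proof -
  have cell: "definable {y. same_signs A x y}" for x
  proof -
    have "{y. same_signs A x y} = \<Inter> ((\<lambda>(a, b). {y. sgn (a \<bullet> y + b) = sgn (a \<bullet> x + b)}) ` A)"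
      unfolding same_signs_def by (fastforce simp: eq_commute)
    also have "definable \<dots>"
      using assms(1,2) by (intro definable_Inter) (auto simp: rational_forms_def intro!: definable_form_sgn)
    finally show ?thesis .
  qed
  have "X = \<Union> ((\<lambda>x. {y. same_signs A x y}) ` X)"
    using assms(3) unfolding determined_def by (auto simp: same_signs_iff)
  moreover have "finite ((\<lambda>x. {y. same_signs A x y}) ` X)"
    by (rule finite_image_by_signs[OF assms(1)]) (auto simp: same_signs_iff)
  ultimately show ?thesis using definable_Union cell by (metis (mono_tags, lifting) imageE)
qed

lemma definable_rational_section:
  assumes "definable X" "rational_section X S" shows "definable S"
proof -
  obtain i c where S: "c \<in> \<rat>" "S = X \<inter> {x. x $ i = c}"
    using assms(2) by (auto simp: rational_section_def)
  have "rat_vec (axis i 1)" by (simp add: rat_vec_def axis_def)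
  then have "definable {x. sgn (axis i 1 \<bullet> x + - c) = 0}" using S(1) by (intro definable_form_sgn) auto
  moreover have "{x. sgn (axis i 1 \<bullet> x + - c) = 0} = {x. x $ i = c}"
    by (auto simp: sgn_if inner_axis' split: if_splits)
  ultimately show ?thesis using definable_Int[OF assms(1)] S(2) by simp
qed

text \<open>Near \<open>x\<close>, the forms that do not vanish at \<open>x\<close> keep their sign,
  and those that vanish at \<open>x\<close> do not change along \<open>v\<close>.\<close>

lemma Str_determined:
  assumes "finite A" "determined A X" and v: "\<And>a b. (a, b) \<in> A \<Longrightarrow> a \<bullet> x + b = 0 \<Longrightarrow> a \<bullet> v = 0"
  shows "v \<in> Str X x"
proof -
  have "\<forall>\<^sub>F p in nhds (x, 0::real). sgn (a \<bullet> fst p + b) = sgn (a \<bullet> (fst p + snd p *\<^sub>R v) + b)"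
    if ab: "(a, b) \<in> A" for a b
  proof (cases "a \<bullet> x + b = 0")
    case True
    then show ?thesis using v[OF ab] by (simp add: inner_add_right)
  next
    case False
    have ev: "\<forall>\<^sub>F y in nhds x. sgn (a \<bullet> y + b) = sgn (a \<bullet> x + b)"
    proof (cases "a \<bullet> x + b > 0")
      case True
      have "((\<lambda>y. a \<bullet> y + b) \<longlongrightarrow> a \<bullet> x + b) (nhds x)" by (intro tendsto_intros filterlim_ident)
      from order_tendstoD(1)[OF this True] show ?thesis using True by (auto elim!: eventually_mono)
    next
      case F: False
      then have lt: "a \<bullet> x + b < 0" using False by simp
      have "((\<lambda>y. a \<bullet> y + b) \<longlongrightarrow> a \<bullet> x + b) (nhds x)" by (intro tendsto_intros filterlim_ident)
      from order_tendstoD(2)[OF this lt] show ?thesis using lt by (auto elim!: eventually_mono)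
    qed
    have "\<forall>\<^sub>F p in nhds (x, 0::real). sgn (a \<bullet> fst p + b) = sgn (a \<bullet> x + b)"
      "\<forall>\<^sub>F p in nhds (x, 0::real). sgn (a \<bullet> (fst p + snd p *\<^sub>R v) + b) = sgn (a \<bullet> x + b)"
      by (rule eventually_nhds_compose[OF ev]; auto intro!: continuous_intros)+
    then show ?thesis by eventually_elim simp
  qed
  then have "\<forall>\<^sub>F p in nhds (x, 0::real). \<forall>f\<in>A. sgn (fst f \<bullet> fst p + snd f) = sgn (fst f \<bullet> (fst p + snd p *\<^sub>R v) + snd f)"
    using assms(1) by (intro eventually_ball_finite) auto
  then show ?thesis unfolding Str_iff
  proof eventually_elim
    case (elim p)
    then have "same_signs A (fst p) (fst p + snd p *\<^sub>R v)" "same_signs A (fst p + snd p *\<^sub>R v) (fst p)"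
      by (auto simp: same_signs_iff)
    then show ?case using assms(2) unfolding determined_def by blast
  qed
qed

text \<open>By \<open>Str_determined\<close>, a singular point is the only common zero of the forms
  in \<open>A\<close> that vanish at it. Hence it is determined by its cell, and it is the unique
  solution of a rational linear system.\<close>

lemma definable_singular:
  fixes X :: "(real ^ 'n) set"
  assumes "definable X"
  shows "finite {x. singular X x}" "singular X x \<Longrightarrow> rat_vec x"
proof -
  obtain A where A: "finite A" "rational_forms A" "determined A X"
    using definable_imp_determined[OF assms] by blast
  have unique: "x = y"
    if "singular X x" "\<And>a b. (a, b) \<in> A \<Longrightarrow> a \<bullet> x + b = 0 \<Longrightarrow> a \<bullet> y + b = 0" for x y
  proof -
    have "y - x \<in> Str X x"
      by (rule Str_determined[OF A(1,3)]) (use that(2) in \<open>force simp: inner_diff_right\<close>)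
    then show ?thesis using that(1) by (simp add: singular_def)
  qed
  have "finite ((\<lambda>x. x) ` {x. singular X x})"
  proof (rule finite_image_by_signs[OF A(1)])
    fix x y assume xy: "x \<in> {x. singular X x}" "same_signs A x y"
    then have s: "sgn (a \<bullet> x + b) = sgn (a \<bullet> y + b)" if "(a, b) \<in> A" for a b
      using that by (auto simp: same_signs_iff)
    show "x = y"
    proof (rule unique)
      show "a \<bullet> y + b = 0" if "(a, b) \<in> A" "a \<bullet> x + b = 0" for a b using s[OF that(1)] that(2) by (simp add: sgn_zero_iff)
    qed (use xy in auto)
  qed
  then show "finite {x. singular X x}" by simp
  assume x: "singular X x"
  obtain \<pi> :: "real \<Rightarrow> real \<Rightarrow> real" where \<pi>: "\<And>b x. \<pi> b x \<in> \<rat>"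
    "\<And>b x y. \<pi> b (x + y) = \<pi> b x + \<pi> b y" "\<And>b q x. q \<in> \<rat> \<Longrightarrow> \<pi> b (q * x) = q * \<pi> b x"
    "\<And>x. x = (\<Sum>b | \<pi> b x \<noteq> 0. \<pi> b x * b)"
    by (rule rational_coordinates) blast
  obtain \<beta> where \<beta>: "\<pi> \<beta> 1 \<noteq> 0" 
  proof -
    have "{b. \<pi> b 1 \<noteq> 0} \<noteq> {}" using \<pi>(4)[of 1] by (intro notI) simp
    then show thesis using that by blast
  qed
  \<comment> \<open>A Q-linear map from the reals to the rationals that fixes the rationals; this is
    why the coordinate of 1 at \<open>\<beta>\<close> must not be 0. Applied to each coordinate of
    \<open>x\<close>, it preserves all rational equations satisfied by \<open>x\<close>.\<close>
  define h where "h r = \<pi> \<beta> r / \<pi> \<beta> 1" for r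
  have h: "h r \<in> \<rat>" "h (r + s) = h r + h s" "q \<in> \<rat> \<Longrightarrow> h (q * r) = q * h r" for q r s
    using \<pi>(1-3) by (auto simp: h_def add_divide_distrib)
  have hq: "h q = q" if "q \<in> \<rat>" for q using h(3)[of q 1] that \<beta> by (simp add: h_def)
  have h_sum: "h (sum f I) = (\<Sum>i\<in>I. h (f i))" if "finite I" for f and I :: "'n set"
    using that hq[of 0] by (induction I rule: finite_induct) (auto simp: h(2))
  define y :: "real ^ 'n" where "y = (\<chi> i. h (x $ i))"
  have "a \<bullet> y + b = 0" if "(a, b) \<in> A" "a \<bullet> x + b = 0" for a b
  proof -
    have ab: "rat_vec a" "b \<in> \<rat>" using that(1) A(2) by (auto simp: rational_forms_def)
    have "a \<bullet> y + b = (\<Sum>i\<in>UNIV. h (a $ i * x $ i)) + h b"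
      using ab by (simp add: y_def inner_vec_def h(3) rat_vec_def hq)
    also have "\<dots> = h (a \<bullet> x + b)" by (simp add: h_sum h(2) inner_vec_def)
    finally show ?thesis using that(2) hq[of 0] by simp
  qed
  from unique[OF x this] have "x = y" .
  moreover have "rat_vec y" using h(1) by (simp add: rat_vec_def y_def)
  ultimately show "rat_vec x" by simp
qed

section \<open>Rational leaves\<close>

lemma subspace_forms:
  fixes W :: "(real ^ 'n) set"
  assumes "subspace W"
  obtains G where "finite G" "\<And>w. w \<in> W \<longleftrightarrow> (\<forall>g\<in>G. g \<bullet> w = 0)"
proof -
  obtain B where B: "finite B" "span B = orthogonal_comp W"
    using basis_subspace_exists[OF subspace_orthogonal_comp[of W]] by metis
  have "w \<in> W \<longleftrightarrow> (\<forall>g\<in>B. g \<bullet> w = 0)" for w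
  proof
    assume "w \<in> W"
    then show "\<forall>g\<in>B. g \<bullet> w = 0"
      using span_base[of _ B] B(2) by (auto simp: orthogonal_comp_def orthogonal_def inner_commute)
  next
    assume *: "\<forall>g\<in>B. g \<bullet> w = 0"
    have "orthogonal g w" if "g \<in> span B" for g
      using orthogonal_to_span[OF that, of w] * by (auto simp: orthogonal_def inner_commute)
    then have "w \<in> orthogonal_comp (orthogonal_comp W)"
      by (auto simp: B(2) orthogonal_comp_def[of "orthogonal_comp W"])
    then show "w \<in> W" using orthogonal_comp_self[OF assms] by simp
  qed
  then show thesis using that B(1) by blast
qed

text \<open>Each real normal \<open>g\<close> is a finite combination of the rational vectors
  \<open>part b g\<close>, so the parts cut out at most \<open>W\<close>. They also vanish on
  \<open>W\<close>: for rational \<open>w'\<close> in \<open>W\<close>, Q-linearity gives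
  \<open>part b g \<bullet> w' = \<pi> b (g \<bullet> w') = 0\<close>, and such \<open>w'\<close>
  span \<open>W\<close>.\<close>

lemma rational_subspace_forms:
  fixes W :: "(real ^ 'n) set"
  assumes "subspace W" and rat: "W \<subseteq> span {w\<in>W. rat_vec w}"
  obtains G where "finite G" "\<And>g. g \<in> G \<Longrightarrow> rat_vec g" "\<And>w. w \<in> W \<longleftrightarrow> (\<forall>g\<in>G. g \<bullet> w = 0)"
proof -
  obtain G where G: "finite G" "\<And>w. w \<in> W \<longleftrightarrow> (\<forall>g\<in>G. g \<bullet> w = 0)"
    using subspace_forms[OF assms(1)] by blast
  obtain \<pi> :: "real \<Rightarrow> real \<Rightarrow> real" where \<pi>: "\<And>b x. \<pi> b x \<in> \<rat>"
    "\<And>b x y. \<pi> b (x + y) = \<pi> b x + \<pi> b y" "\<And>b q x. q \<in> \<rat> \<Longrightarrow> \<pi> b (q * x) = q * \<pi> b x"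
    "\<And>x. finite {b. \<pi> b x \<noteq> 0}" "\<And>x. x = (\<Sum>b | \<pi> b x \<noteq> 0. \<pi> b x * b)"
    by (rule rational_coordinates) blast
  have \<pi>0: "\<pi> b 0 = 0" for b using \<pi>(2)[of b 0 0] by simp
  have \<pi>_sum: "\<pi> b (sum f I) = (\<Sum>i\<in>I. \<pi> b (f i))" if "finite I" for b f and I :: "'n set"
    using that by (induction I rule: finite_induct) (auto simp: \<pi>(2) \<pi>0)
  define part :: "real \<Rightarrow> real ^ 'n \<Rightarrow> real ^ 'n" where "part b g = (\<chi> i. \<pi> b (g $ i))" for b g
  define supp where "supp g = (\<Union>i. {b. \<pi> b (g $ i) \<noteq> 0})" for g :: "real ^ 'n"
  have fin_supp: "finite (supp g)" for g by (simp add: supp_def \<pi>(4))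
  have split: "g = (\<Sum>b\<in>supp g. b *\<^sub>R part b g)" for g
  proof (rule vec_eq_iff[THEN iffD2, rule_format])
    fix i
    have "g $ i = (\<Sum>b | \<pi> b (g $ i) \<noteq> 0. \<pi> b (g $ i) * b)" by (rule \<pi>(5))
    also have "\<dots> = (\<Sum>b\<in>supp g. \<pi> b (g $ i) * b)"
      by (rule sum.mono_neutral_left[OF fin_supp]) (auto simp: supp_def)
    finally show "g $ i = (\<Sum>b\<in>supp g. b *\<^sub>R part b g) $ i" by (simp add: part_def mult.commute)
  qed
  define G' where "G' = (\<Union>g\<in>G. (\<lambda>b. part b g) ` supp g)"
  have orth: "part b g \<bullet> w = 0" if "g \<in> G" "w \<in> W" for b g w
  proof -
    have "part b g \<bullet> w' = 0" if "w' \<in> W" "rat_vec w'" for w'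
    proof -
      have "\<pi> b (g $ i * w' $ i) = part b g $ i * w' $ i" for i
        using \<pi>(3)[of "w' $ i" b "g $ i"] that(2) by (simp add: mult.commute part_def rat_vec_def)
      then have "part b g \<bullet> w' = \<pi> b (g \<bullet> w')" by (simp add: \<pi>_sum inner_vec_def)
      then show ?thesis using G(2) \<open>g \<in> G\<close> that(1) by (simp add: \<pi>0)
    qed
    then show ?thesis
      using orthogonal_to_span[of w "{w\<in>W. rat_vec w}" "part b g"] rat that(2)
      by (auto simp: orthogonal_def)
  qed
  have "w \<in> W" if *: "\<forall>g\<in>G'. g \<bullet> w = 0" for w
  proof -
    have "g \<bullet> w = 0" if "g \<in> G" for g
    proof -
      have "g \<bullet> w = (\<Sum>b\<in>supp g. b *\<^sub>R part b g) \<bullet> w" using split[of g] by simp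
      also have "\<dots> = (\<Sum>b\<in>supp g. b * (part b g \<bullet> w))" by (simp add: inner_sum_left)
      also have "\<dots> = 0" using * that by (intro sum.neutral) (auto simp: G'_def)
      finally show ?thesis .
    qed
    then show ?thesis using G(2) by blast
  qed
  then have "w \<in> W \<longleftrightarrow> (\<forall>g\<in>G'. g \<bullet> w = 0)" for w using orth by (auto simp: G'_def)
  moreover have "finite G'" using G(1) fin_supp by (simp add: G'_def)
  moreover have "rat_vec g" if "g \<in> G'" for g using that \<pi>(1) by (auto simp: G'_def rat_vec_def part_def)
  ultimately show thesis using that by blast
qed

lemma forms_through_point:
  fixes p :: "real ^ 'n"
  assumes "p \<in> leaf X x" "finite G" "\<And>w. w \<in> Str X x \<longleftrightarrow> (\<forall>g\<in>G. g \<bullet> w = 0)"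
  shows "finite ((\<lambda>g. (g, - (g \<bullet> p))) ` G)"
    "y \<in> leaf X x \<longleftrightarrow> (\<forall>(a, b)\<in>(\<lambda>g. (g, - (g \<bullet> p))) ` G. a \<bullet> y + b = 0)"
proof -
  show "finite ((\<lambda>g. (g, - (g \<bullet> p))) ` G)" using assms(2) by simp
  have "y - x \<in> Str X x \<longleftrightarrow> y - p \<in> Str X x"
    using assms(1) subspace_add[OF subspace_Str, of "y - p" X x "p - x"]
      subspace_diff[OF subspace_Str, of "y - x" X x "p - x"] by (auto simp: leaf_def)
  then show "y \<in> leaf X x \<longleftrightarrow> (\<forall>(a, b)\<in>(\<lambda>g. (g, - (g \<bullet> p))) ` G. a \<bullet> y + b = 0)"
    by (simp add: leaf_def assms(3) inner_diff_right)
qed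

lemma leaf_forms:
  "\<exists>A. finite A \<and> (\<forall>y. y \<in> leaf X x \<longleftrightarrow> (\<forall>(a, b)\<in>A. a \<bullet> y + b = 0))"
proof -
  obtain G where "finite G" "\<And>w. w \<in> Str X x \<longleftrightarrow> (\<forall>g\<in>G. g \<bullet> w = 0)"
    using subspace_forms[OF subspace_Str] by blast
  from forms_through_point[OF mem_leaf_self this] show ?thesis by blast
qed

text \<open>Stated by a rational point and rational spanning vectors, since this is what moving to
  sections produces; \<open>rational_leaf_forms\<close> converts it into the rational equations that
  definability requires.\<close>

definition rational_leaf :: "(real ^ 'n) set \<Rightarrow> real ^ 'n \<Rightarrow> bool" where
  "rational_leaf X x \<longleftrightarrow> (\<exists>p\<in>leaf X x. rat_vec p) \<and> Str X x \<subseteq> span {w \<in> Str X x. rat_vec w}"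

lemma rational_leaf_forms:
  assumes "rational_leaf X x"
  shows "\<exists>A. finite A \<and> rational_forms A \<and> (\<forall>y. y \<in> leaf X x \<longleftrightarrow> (\<forall>(a, b)\<in>A. a \<bullet> y + b = 0))"
proof -
  obtain p where p: "p \<in> leaf X x" "rat_vec p" using assms by (auto simp: rational_leaf_def)
  obtain G where G: "finite G" "\<And>g. g \<in> G \<Longrightarrow> rat_vec g" "\<And>w. w \<in> Str X x \<longleftrightarrow> (\<forall>g\<in>G. g \<bullet> w = 0)"
    using assms unfolding rational_leaf_def
    by (elim conjE rational_subspace_forms[OF subspace_Str]) blast
  have "g \<bullet> p \<in> \<rat>" if "rat_vec g" for g
    unfolding inner_vec_def using that p(2) by (intro Rats_sum) (auto simp: rat_vec_def)
  then have rat: "rational_forms ((\<lambda>g. (g, - (g \<bullet> p))) ` G)" using G(2) by (auto simp: rational_forms_def)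
  show ?thesis
    by (intro exI[of _ "(\<lambda>g. (g, - (g \<bullet> p))) ` G"] conjI allI rat forms_through_point[OF p(1) G(1,3)])
qed

lemma dim_Str_less:
  assumes "Str X x \<subset> Str Y y" shows "dim (Str X x) < dim (Str Y y)"
proof -
  have "span (Str X x) = Str X x" "span (Str Y y) = Str Y y"
    using subspace_Str span_eq_iff by blast+
  then show ?thesis using dim_psubset[of "Str X x" "Str Y y"] assms by metis
qed

text \<open>Moving along a stratum to two parallel rational hyperplanes produces two rational points of the
  leaf whose difference is transversal to the hyperplanes.\<close>

lemma rational_leaf_from_sections:
  fixes X :: "(real ^ 'n) set"
  assumes sec: "\<And>i c y. c \<in> \<rat> \<Longrightarrow> Str (X \<inter> {y. y $ i = c}) y \<subset> Str X x \<Longrightarrow>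
      rational_leaf (X \<inter> {y. y $ i = c}) y"
    and x: "Str X x \<noteq> {0}" "Str X x \<noteq> UNIV"
  shows "rational_leaf X x"
proof -
  obtain u0 where u0: "u0 \<in> Str X x" "u0 \<noteq> 0" using x(1) subspace_0[OF subspace_Str] by blast
  then obtain i where i: "u0 $ i \<noteq> 0" by (auto simp: vec_eq_iff)
  define u where "u = (1 / u0 $ i) *\<^sub>R u0"
  have u: "u \<in> Str X x" "u $ i = 1" using u0 i subspace_scale[OF subspace_Str] by (auto simp: u_def)
  let ?W = "Str X x \<inter> {w. w $ i = 0}"
  have "\<forall>\<^sub>F t in nhds 0. loc_eq X x (x + t *\<^sub>R u)"
    using eventually_nhds_compose[OF loc_eq_along_near[OF u(1)], where f = "\<lambda>t. (x, t)" and a = 0]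
    by (simp add: continuous_intros)
  then obtain e where e: "e > 0" "\<And>t. \<bar>t\<bar> < e \<Longrightarrow> loc_eq X x (x + t *\<^sub>R u)"
    unfolding eventually_nhds_metric by (auto simp: dist_real_def)
  have key: "(\<exists>p. rat_vec p \<and> p $ i = c \<and> p - x \<in> Str X x) \<and> ?W \<subseteq> span {w \<in> ?W. rat_vec w}"
    if c: "c \<in> \<rat>" "\<bar>c - x $ i\<bar> < e" for c
  proof -
    let ?Y = "X \<inter> {y. y $ i = c}"
    define y where "y = x + (c - x $ i) *\<^sub>R u"
    have yi: "y $ i = c" using u(2) by (simp add: y_def)
    have "Str X y = Str X x" using Str_loc_eq[OF e(2)[OF c(2)]] by (simp add: y_def)
    then have StrY: "Str ?Y y = ?W" using Str_section[OF yi, of u X] u x(2) by simp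
    moreover have "?W \<subset> Str X x" using u by force
    ultimately have rl: "rational_leaf ?Y y" using sec[OF c(1), of i y] by simp
    then obtain p where p: "p - y \<in> ?W" "rat_vec p" by (auto simp: rational_leaf_def leaf_def StrY)
    have "(p - y) + (c - x $ i) *\<^sub>R u \<in> Str X x"
      using subspace_add[OF subspace_Str, of "p - y" X x] subspace_scale[OF subspace_Str u(1)] p(1) by blast
    then have "p - x \<in> Str X x" by (simp add: y_def)
    moreover have "p $ i = c" using p(1) yi by simp
    ultimately show ?thesis using p(2) rl by (auto simp: rational_leaf_def StrY)
  qed
  obtain c where c: "c \<in> \<rat>" "x $ i < c" "c < x $ i + e"
    using Rats_dense_in_real[of "x $ i" "x $ i + e"] e(1) by auto
  obtain c' where c': "c' \<in> \<rat>" "x $ i < c'" "c' < c" using Rats_dense_in_real[OF c(2)] by auto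
  obtain p where p: "rat_vec p" "p $ i = c" "p - x \<in> Str X x" and W: "?W \<subseteq> span {w \<in> ?W. rat_vec w}"
    using key[of c] c by auto
  obtain p' where p': "rat_vec p'" "p' $ i = c'" "p' - x \<in> Str X x" using key[of c'] c c' by auto
  define d where "d = p - p'"
  have "d = (p - x) - (p' - x)" by (simp add: d_def)
  then have d: "d \<in> Str X x" "rat_vec d" "d $ i \<noteq> 0"
    using subspace_diff[OF subspace_Str p(3) p'(3)] p p' c' by (auto simp: rat_vec_def)
  let ?R = "{w \<in> Str X x. rat_vec w}"
  have "w \<in> span ?R" if w: "w \<in> Str X x" for w
  proof -
    have "w - (w $ i / d $ i) *\<^sub>R d \<in> ?W"
      using subspace_diff[OF subspace_Str w subspace_scale[OF subspace_Str d(1), of "w $ i / d $ i"]] d(3) by simp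
    then have "w - (w $ i / d $ i) *\<^sub>R d \<in> span ?R" using W span_mono[of "{w \<in> ?W. rat_vec w}" ?R] by blast
    from span_add[OF this span_scale[OF span_base[of d ?R], of "w $ i / d $ i"]] show ?thesis using d by simp
  qed
  then show ?thesis using p by (auto simp: rational_leaf_def leaf_def)
qed

lemma rational_leaf_singular:
  assumes "singular X x" "rat_vec x" shows "rational_leaf X x"
proof -
  have "Str X x \<subseteq> span {w \<in> Str X x. rat_vec w}"
    using assms(1) span_zero by (simp add: singular_def)
  then show ?thesis unfolding rational_leaf_def using assms(2) mem_leaf_self by blast
qed

text \<open>The set varies in the induction, because sections of definable sets are definable again.
  For the \<open>X\<close> of the theorem definability is known only of its rational sections, to
  which this lemma is applied.\<close>

lemma rational_leaf_definable:
  assumes "definable Y" "Str Y y \<noteq> UNIV" shows "rational_leaf Y y"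
  using assms
proof (induction "dim (Str Y y)" arbitrary: Y y rule: less_induct)
  case less
  show ?case
  proof (cases "Str Y y = {0}")
    case True
    then show ?thesis using definable_singular(2)[OF less.prems(1)] by (simp add: rational_leaf_singular singular_def)
  next
    case False
    show ?thesis
    proof (rule rational_leaf_from_sections[OF _ False less.prems(2)])
      fix i c z assume "c \<in> \<rat>" and lt: "Str (Y \<inter> {y. y $ i = c}) z \<subset> Str Y y"
      then have "definable (Y \<inter> {y. y $ i = c})"
        using definable_rational_section[OF less.prems(1)] by (auto simp: rational_section_def)
      \<comment> \<open>The strict inclusion provides both the smaller dimension and that the strata
        of the section at \<open>z\<close> are not all of \<open>UNIV\<close>.\<close>
      then show "rational_leaf (Y \<inter> {y. y $ i = c}) z" using less.hyps[OF dim_Str_less[OF lt]] lt by blast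
    qed
  qed
qed

section \<open>Limits along intervals, and rationals separating finitely many reals\<close>

lemma closure_eventually_witness:
  assumes "b \<in> closure K" "\<forall>\<^sub>F s in nhds b. P s" shows "\<exists>s\<in>K. P s"
proof -
  obtain U where "open U" "b \<in> U" "\<forall>s\<in>U. P s" using assms(2) unfolding eventually_nhds by blast
  then show ?thesis using assms(1) unfolding closure_iff_nhds_not_empty by blast
qed

lemma separating_rationals:
  fixes F :: "real set"
  assumes "finite F"
  obtains C where "finite C" "C \<subseteq> \<rat>"
    "\<And>K. open K \<Longrightarrow> connected K \<Longrightarrow> K \<noteq> {} \<Longrightarrow> frontier K \<subseteq> F \<Longrightarrow> \<exists>c\<in>C. c \<in> K"
proof -
  have "\<exists>q. \<forall>p :: real \<times> real. q p \<in> \<rat> \<and> (fst p < snd p \<longrightarrow> fst p < q p \<and> q p < snd p)"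
  proof (rule choice, rule allI)
    show "\<exists>q. q \<in> \<rat> \<and> (fst p < snd p \<longrightarrow> fst p < q \<and> q < snd p)" for p :: "real \<times> real"
      using Rats_dense_in_real[of "fst p" "snd p"] by (cases "fst p < snd p") auto
  qed
  then obtain q :: "real \<times> real \<Rightarrow> real" where q: "\<And>p. q p \<in> \<rat>" "\<And>p. fst p < snd p \<Longrightarrow> fst p < q p \<and> q p < snd p"
    by blast
  \<comment> \<open>\<open>K\<close> is an interval with end points in \<open>F\<close>. The values
    \<open>q\<close> serve bounded \<open>K\<close>, the integers strictly beyond a point of
    \<open>F\<close> serve half-lines, and 0 serves the whole line.\<close>
  define C where "C = {0} \<union> q ` (F \<times> F) \<union> (\<lambda>a. of_int (\<lceil>a\<rceil> + 1)) ` F \<union> (\<lambda>a. of_int (\<lfloor>a\<rfloor> - 1)) ` F"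
  show thesis
  proof (rule that[of C])
    show "finite C" using assms by (simp add: C_def)
    show "C \<subseteq> \<rat>" using q(1) by (auto simp: C_def)
  next
    fix K :: "real set" assume K: "open K" "connected K" "K \<noteq> {}" "frontier K \<subseteq> F"
    have in_K: "c \<in> K" if "\<exists>k\<in>K. k \<le> c" "\<exists>k\<in>K. c \<le> k" for c
      using that connectedD_interval[OF K(2)] by metis
    have below: "\<exists>a\<in>F. (\<forall>k\<in>K. a < k) \<and> (\<forall>c>a. \<exists>k\<in>K. k \<le> c)" if bdd: "bdd_below K"
    proof (rule bexI[of _ "Inf K"], intro conjI allI impI ballI)
      have notin: "Inf K \<notin> K"
      proof
        assume "Inf K \<in> K"
        then obtain e where e: "e > 0" "ball (Inf K) e \<subseteq> K" using K(1) by (meson open_contains_ball)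
        then have "Inf K - e / 2 \<in> K" by (auto simp: dist_real_def subset_iff)
        then show False using cInf_lower[OF _ bdd, of "Inf K - e / 2"] e(1) by simp
      qed
      show "Inf K \<in> F" using closure_contains_Inf[OF K(3) bdd] notin K(1,4) by (auto simp: frontier_def interior_open)
      show "Inf K < k" if "k \<in> K" for k using cInf_lower[OF that bdd] notin that by (metis order_le_less)
      show "\<exists>k\<in>K. k \<le> c" if "c > Inf K" for c using cInf_lessD[OF K(3) that] by (meson less_imp_le)
    qed
    have above: "\<exists>b\<in>F. (\<forall>k\<in>K. k < b) \<and> (\<forall>c<b. \<exists>k\<in>K. c \<le> k)" if bdd: "bdd_above K"
    proof (rule bexI[of _ "Sup K"], intro conjI allI impI ballI)
      have notin: "Sup K \<notin> K"
      proof
        assume "Sup K \<in> K"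
        then obtain e where e: "e > 0" "ball (Sup K) e \<subseteq> K" using K(1) by (meson open_contains_ball)
        then have "Sup K + e / 2 \<in> K" by (auto simp: dist_real_def subset_iff)
        then show False using cSup_upper[OF _ bdd, of "Sup K + e / 2"] e(1) by simp
      qed
      show "Sup K \<in> F" using closure_contains_Sup[OF K(3) bdd] notin K(1,4) by (auto simp: frontier_def interior_open)
      show "k < Sup K" if "k \<in> K" for k using cSup_upper[OF that bdd] notin that by (metis order_le_less)
      show "\<exists>k\<in>K. c \<le> k" if "c < Sup K" for c using less_cSupD[OF K(3) that] by (meson less_imp_le)
    qed
    have below': "\<exists>k\<in>K. k \<le> c" if "\<not> bdd_below K" for c
      using that unfolding bdd_below_def by (meson linear)
    have above': "\<exists>k\<in>K. c \<le> k" if "\<not> bdd_above K" for c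
      using that unfolding bdd_above_def by (meson linear)
    consider "bdd_below K" "bdd_above K" | "bdd_below K" "\<not> bdd_above K"
      | "\<not> bdd_below K" "bdd_above K" | "\<not> bdd_below K" "\<not> bdd_above K" by metis
    then show "\<exists>c\<in>C. c \<in> K"
    proof cases
      case 1
      obtain a where a: "a \<in> F" "\<forall>k\<in>K. a < k" "\<forall>c>a. \<exists>k\<in>K. k \<le> c" using below[OF 1(1)] by blast
      obtain b where b: "b \<in> F" "\<forall>k\<in>K. k < b" "\<forall>c<b. \<exists>k\<in>K. c \<le> k" using above[OF 1(2)] by blast
      have "a < b" using a(2) b(2) K(3) by fastforce
      then have "a < q (a, b)" "q (a, b) < b" using q(2)[of "(a, b)"] by auto
      then have "q (a, b) \<in> K" by (intro in_K a(3)[rule_format] b(3)[rule_format])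
      then show ?thesis using a(1) b(1) by (intro bexI[of _ "q (a, b)"]) (auto simp: C_def)
    next
      case 2
      obtain a where a: "a \<in> F" "\<forall>c>a. \<exists>k\<in>K. k \<le> c" using below[OF 2(1)] by blast
      have "a < of_int (\<lceil>a\<rceil> + 1)" by linarith
      then have "of_int (\<lceil>a\<rceil> + 1) \<in> K" by (intro in_K a(2)[rule_format] above'[OF 2(2)])
      then show ?thesis using a(1) by (intro bexI[of _ "of_int (\<lceil>a\<rceil> + 1)"]) (auto simp: C_def)
    next
      case 3
      obtain b where b: "b \<in> F" "\<forall>c<b. \<exists>k\<in>K. c \<le> k" using above[OF 3(2)] by blast
      have "of_int (\<lfloor>b\<rfloor> - 1) < b" by linarith
      then have "of_int (\<lfloor>b\<rfloor> - 1) \<in> K" by (intro in_K b(2)[rule_format] below'[OF 3(1)])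
      then show ?thesis using b(1) by (intro bexI[of _ "of_int (\<lfloor>b\<rfloor> - 1)"]) (auto simp: C_def)
    next
      case 4
      have "0 \<in> K" by (intro in_K below'[OF 4(1)] above'[OF 4(2)])
      then show ?thesis by (intro bexI[of _ 0]) (auto simp: C_def)
    qed
  qed
qed

section \<open>Finiteness of the set of leaves\<close>

text \<open>A stratum line through \<open>x\<close> either crosses a hyperplane \<open>z $ i = c\<close> with \<open>c \<in> C\<close> before its
  local type changes, or ends in a nonsingular point with a smaller space of strata; from there the
  hyperplane reached by that point is also reached by nearby points of the line.\<close>

lemma nonsingular_reaches_hyperplane:
  fixes X :: "(real ^ 'n) set"
  assumes C: "\<And>K. open K \<Longrightarrow> connected K \<Longrightarrow> K \<noteq> {} \<Longrightarrow> frontier K \<subseteq> {x $ i | x i. singular X x} \<Longrightarrow>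
      \<exists>c\<in>C. c \<in> K"
    and "\<not> singular X x"
  shows "\<exists>z i u. z $ i \<in> C \<and> loc_eq X x z \<and> z - x \<in> Str X x \<and> u \<in> Str X x \<and> u $ i \<noteq> 0"
  using assms(2)
proof (induction "dim (Str X x)" arbitrary: x rule: less_induct)
  case less
  obtain v0 where v0: "v0 \<in> Str X x" "v0 \<noteq> 0"
    using less.prems subspace_0[OF subspace_Str] by (fastforce simp: singular_def)
  then obtain i where i: "v0 $ i \<noteq> 0" by (auto simp: vec_eq_iff)
  define v where "v = (1 / v0 $ i) *\<^sub>R v0"
  have v: "v \<in> Str X x" "v $ i = 1" using v0 i subspace_scale[OF subspace_Str] by (auto simp: v_def)
  \<comment> \<open>As \<open>v $ i = 1\<close>, the parameter of \<open>q\<close> is the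
    \<open>i\<close>-th coordinate itself, so end points of \<open>K\<close> can be compared with
    coordinates of singular points.\<close>
  define q where "q s = (x - (x $ i) *\<^sub>R v) + s *\<^sub>R v" for s
  have q_x: "q (x $ i) = x" by (simp add: q_def)
  have q_i: "q s $ i = s" for s using v(2) by (simp add: q_def)
  have q_diff: "q s - x = (s - x $ i) *\<^sub>R v" for s by (simp add: q_def scaleR_left_diff_distrib)
  have q_cont: "isCont q s" for s unfolding q_def by (intro continuous_intros)
  define T where "T = {s. v \<in> Str X (q s)}"
  have "open T"
  proof (rule open_subopen[THEN iffD2], intro ballI)
    fix s assume "s \<in> T"
    then have "\<forall>\<^sub>F r in nhds s. v \<in> Str X (q r)"
      using eventually_nhds_compose[OF Str_near q_cont refl] by (auto simp: T_def)
    then show "\<exists>U. open U \<and> s \<in> U \<and> U \<subseteq> T" unfolding eventually_nhds T_def by blast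
  qed
  define K where "K = connected_component_set T (x $ i)"
  have "x $ i \<in> T" using v(1) q_x by (simp add: T_def)
  then have K: "open K" "connected K" "x $ i \<in> K" "K \<subseteq> T"
    using open_connected_component[OF \<open>open T\<close>] connected_component_subset[of T "x $ i"]
    by (auto simp: K_def)
  have loc: "loc_eq X x (q s)" if "s \<in> K" for s
    using loc_eq_along_line[OF K(2,3) that, of v X "x - (x $ i) *\<^sub>R v"] K(4) q_x
    by (auto simp: T_def q_def)
  show ?case
  proof (cases "\<exists>c\<in>C. c \<in> K")
    case True
    then obtain c where c: "c \<in> C" "c \<in> K" by blast
    have "q c - x \<in> Str X x" using q_diff subspace_scale[OF subspace_Str v(1)] by simp
    then show ?thesis using c loc q_i v by (intro exI[of _ "q c"] exI[of _ i] exI[of _ v]) auto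
  next
    case False
    then obtain \<beta> where \<beta>: "\<beta> \<in> frontier K" "\<beta> \<notin> {x $ i | x i. singular X x}"
      using C[OF K(1,2)] K(3) by blast
    then have \<beta>K: "\<beta> \<in> closure K" "\<beta> \<notin> K" using K(1) by (auto simp: frontier_def interior_open)
    define y where "y = q \<beta>"
    have "\<not> singular X y"
    proof
      assume "singular X y"
      then have "y $ i \<in> {x $ i | x i. singular X x}" by blast
      then show False using \<beta>(2) q_i[of \<beta>] unfolding y_def by metis
    qed
    have "\<beta> \<notin> T"
    proof
      assume "\<beta> \<in> T"
      moreover have "connected (insert \<beta> K)"
        by (rule connected_intermediate_closure[OF K(2)]) (use \<beta>K closure_subset in auto)
      ultimately have "insert \<beta> K \<subseteq> K"
        unfolding K_def using K(3,4) by (intro connected_component_maximal) (auto simp: K_def)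
      then show False using \<beta>K(2) by blast
    qed
    then have vy: "v \<notin> Str X y" by (simp add: T_def y_def)
    have sub: "Str X y \<subseteq> Str X x"
    proof
      fix w assume "w \<in> Str X y"
      then have "\<forall>\<^sub>F s in nhds \<beta>. w \<in> Str X (q s)"
        using eventually_nhds_compose[OF Str_near q_cont] by (simp add: y_def)
      from closure_eventually_witness[OF \<beta>K(1) this] show "w \<in> Str X x" using Str_loc_eq[OF loc] by blast
    qed
    then have "Str X y \<subset> Str X x" using vy v(1) by blast
    from less.hyps[OF dim_Str_less[OF this] \<open>\<not> singular X y\<close>] obtain z j u where
      z: "z $ j \<in> C" "loc_eq X y z" "z - y \<in> Str X y" and u: "u \<in> Str X y" "u $ j \<noteq> 0" by blast
    \<comment> \<open>The shift along \<open>v\<close> changes the \<open>j\<close>-th coordinate by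
      \<open>(s - \<beta>) * v $ j\<close>; moving by \<open>r s\<close> along \<open>u\<close>
      restores it and returns to the hyperplane of \<open>z\<close>.\<close>
    define r where "r s = - ((s - \<beta>) * v $ j / u $ j)" for s
    have "\<forall>\<^sub>F s in nhds \<beta>. loc_eq X (y + (s - \<beta>) *\<^sub>R v) (z + (s - \<beta>) *\<^sub>R v)"
      using eventually_nhds_compose[OF loc_eq_near[OF z(2)], where f = "\<lambda>s. (s - \<beta>) *\<^sub>R v" and a = \<beta>]
      by (simp add: continuous_intros)
    moreover have "\<forall>\<^sub>F s in nhds \<beta>. loc_eq X (z + (s - \<beta>) *\<^sub>R v) (z + (s - \<beta>) *\<^sub>R v + r s *\<^sub>R u)"
    proof -
      have "u \<in> Str X z" using u(1) Str_loc_eq[OF z(2)] by simp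
      moreover have "isCont (\<lambda>s. (z + (s - \<beta>) *\<^sub>R v, r s)) \<beta>"
        unfolding r_def using u(2) by (intro continuous_intros) auto
      ultimately show ?thesis
        using eventually_nhds_compose[OF loc_eq_along_near, where f = "\<lambda>s. (z + (s - \<beta>) *\<^sub>R v, r s)" and a = \<beta>]
        by (simp add: r_def)
    qed
    ultimately have "\<forall>\<^sub>F s in nhds \<beta>. loc_eq X (y + (s - \<beta>) *\<^sub>R v) (z + (s - \<beta>) *\<^sub>R v + r s *\<^sub>R u)"
      by eventually_elim (rule loc_eq_trans)
    from closure_eventually_witness[OF \<beta>K(1) this] obtain s where
      s: "s \<in> K" "loc_eq X (y + (s - \<beta>) *\<^sub>R v) (z + (s - \<beta>) *\<^sub>R v + r s *\<^sub>R u)" by blast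
    define z' where "z' = z + (s - \<beta>) *\<^sub>R v + r s *\<^sub>R u"
    have "y + (s - \<beta>) *\<^sub>R v = q s" by (simp add: y_def q_def algebra_simps)
    then have "loc_eq X x z'" using loc_eq_trans[OF loc[OF s(1)]] s(2) by (simp add: z'_def)
    moreover have "z' $ j = z $ j" using u(2) by (simp add: z'_def r_def)
    moreover have "z' - x \<in> Str X x"
    proof -
      have "z' - x = ((z - y) + (s - x $ i) *\<^sub>R v) + r s *\<^sub>R u"
        by (simp add: z'_def y_def q_def algebra_simps)
      moreover have "z - y \<in> Str X x" "u \<in> Str X x" using z(3) u(1) sub by auto
      ultimately show ?thesis using v(1) by (simp add: subspace_add subspace_scale subspace_Str)
    qed
    ultimately show ?thesis using z(1) u sub by (intro exI[of _ z'] exI[of _ j] exI[of _ u]) auto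
  qed
qed

text \<open>On a cell of forms that determine the section and cut out all leaves of smaller dimension, the
  transversal points form an open and closed subset: a boundary point would lie on a leaf of smaller
  dimension, which contains the whole cell.\<close>

lemma leaf_eq_on_cell:
  fixes X :: "(real ^ 'n) set"
  assumes A: "finite A" "determined A (X \<inter> {y. y $ i = c})"
    and B: "\<And>b. dim (Str X b) < k \<Longrightarrow> \<exists>D\<subseteq>B. \<forall>y. y \<in> leaf X b \<longleftrightarrow> (\<forall>(a, b)\<in>D. a \<bullet> y + b = 0)"
    and z: "z $ i = c" "dim (Str X z) = k" "u \<in> Str X z" "u $ i \<noteq> 0"
    and z': "z' $ i = c" "same_signs (A \<union> B) z z'"
  shows "leaf X z = leaf X z'"
proof -
  let ?Y = "X \<inter> {y. y $ i = c}"
  define d where "d = z' - z"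
  define q where "q t = z + t *\<^sub>R d" for t
  have d_i: "d $ i = 0" using z(1) z'(1) by (simp add: d_def)
  have q_i: "q t $ i = c" for t using z(1) d_i by (simp add: q_def)
  have q_cont: "isCont q t" for t unfolding q_def by (intro continuous_intros)
  have same: "same_signs (A \<union> B) z (q t)" if "t \<in> {0..1}" for t
    using same_signs_segment[OF z'(2)] that by (simp add: q_def d_def)
  \<comment> \<open>A form of \<open>A\<close> that vanishes at \<open>q t\<close> vanishes at
    \<open>z\<close> and \<open>z'\<close> too, because all three have the same signs; hence it is
    constant along \<open>d\<close>.\<close>
  have dY: "d \<in> Str ?Y (q t)" if t: "t \<in> {0..1}" for t
  proof (rule Str_determined[OF A])
    fix a b assume "(a, b) \<in> A" and 0: "a \<bullet> q t + b = 0"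
    then have "sgn (a \<bullet> z + b) = sgn (a \<bullet> q t + b)" "sgn (a \<bullet> z + b) = sgn (a \<bullet> z' + b)"
      using same[OF t] z'(2) unfolding same_signs_iff by blast+
    then have "a \<bullet> z + b = 0" "a \<bullet> z' + b = 0" using 0 by (simp_all add: sgn_zero_iff)
    then show "a \<bullet> d = 0" by (simp add: d_def inner_diff_right)
  qed
  \<comment> \<open>Parameters with a stratum of \<open>X\<close> transversal to the hyperplane.
    There \<open>Str_section_iff\<close> lifts the stratum \<open>d\<close> of the section to
    \<open>X\<close>.\<close>
  define G where "G = {t. \<exists>u\<in>Str X (q t). u $ i \<noteq> 0}"
  have dX: "d \<in> Str X (q t)" if "t \<in> {0..1}" "t \<in> G" for t
    using that dY[OF that(1)] Str_section_iff[OF q_i[of t] _ _ d_i] by (auto simp: G_def)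
  have "open G"
  proof (rule open_subopen[THEN iffD2], intro ballI)
    fix t assume "t \<in> G"
    then obtain u where u: "u \<in> Str X (q t)" "u $ i \<noteq> 0" by (auto simp: G_def)
    then have "\<forall>\<^sub>F s in nhds t. u \<in> Str X (q s)"
      using eventually_nhds_compose[OF Str_near q_cont refl] by blast
    then show "\<exists>U. open U \<and> t \<in> U \<and> U \<subseteq> G" unfolding eventually_nhds G_def using u(2) by blast
  qed
  have "0 \<in> G" using z(3,4) by (auto simp: G_def q_def)
  have "{0..1} \<subseteq> G"
  proof (rule ccontr)
    assume "\<not> {0..1} \<subseteq> G"
    then have "{0..1} - G \<noteq> {}" by blast
    moreover have "compact ({0..1} - G)" using \<open>open G\<close> by (intro compact_diff) auto
    ultimately obtain \<beta> where \<beta>: "\<beta> \<in> {0..1}" "\<beta> \<notin> G" "\<And>t. t \<in> {0..1} - G \<Longrightarrow> \<beta> \<le> t"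
      using compact_attains_inf[of "{0..1} - G"] by blast
    have "\<beta> \<noteq> 0" using \<beta>(2) \<open>0 \<in> G\<close> by metis
    then have "\<beta> > 0" using \<beta>(1) by simp
    have before: "t \<in> {0..1}" "t \<in> G" if "t \<in> {0..<\<beta>}" for t
      using that \<beta>(1) \<beta>(3)[of t] by auto
    have loc: "loc_eq X z (q t)" if "t \<in> {0..<\<beta>}" for t
      using loc_eq_along_line[of "{0..<\<beta>}" 0 t d X z] that dX before \<open>\<beta> > 0\<close> by (auto simp: q_def)
    have cl: "\<beta> \<in> closure {0..<\<beta>}" using \<open>\<beta> > 0\<close> by simp
    have "Str X (q \<beta>) \<subseteq> Str X z"
    proof
      fix w assume "w \<in> Str X (q \<beta>)"
      then have "\<forall>\<^sub>F t in nhds \<beta>. w \<in> Str X (q t)"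
        using eventually_nhds_compose[OF Str_near q_cont refl] by blast
      from closure_eventually_witness[OF cl this] show "w \<in> Str X z" using Str_loc_eq[OF loc] by blast
    qed
    moreover have "u \<notin> Str X (q \<beta>)" using \<beta>(2) z(4) by (auto simp: G_def)
    ultimately have psub: "Str X (q \<beta>) \<subset> Str X z" using z(3) by blast
    then have "dim (Str X (q \<beta>)) < k" using dim_Str_less z(2) by blast
    then obtain D where D: "D \<subseteq> B" "\<And>y. y \<in> leaf X (q \<beta>) \<longleftrightarrow> (\<forall>(a, b)\<in>D. a \<bullet> y + b = 0)"
      using B by metis
    have "a \<bullet> z + b = 0" if "(a, b) \<in> D" for a b
    proof -
      have "a \<bullet> q \<beta> + b = 0" using D(2)[of "q \<beta>"] that by auto
      moreover have "sgn (a \<bullet> z + b) = sgn (a \<bullet> q \<beta> + b)"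
        using same[OF \<beta>(1)] that D(1) unfolding same_signs_iff by blast
      ultimately show ?thesis by (simp add: sgn_zero_iff)
    qed
    \<comment> \<open>The leaf of \<open>q \<beta>\<close> thus contains the whole segment. So
      \<open>d\<close> is a stratum at \<open>q \<beta>\<close> and the local type cannot change
      there, contrary to the loss of the stratum \<open>u\<close>.\<close>
    then have "z - q \<beta> \<in> Str X (q \<beta>)" using D(2)[of z] by (auto simp: leaf_def)
    then have "(- 1 / \<beta>) *\<^sub>R (z - q \<beta>) \<in> Str X (q \<beta>)" by (rule subspace_scale[OF subspace_Str])
    then have "d \<in> Str X (q \<beta>)" using \<open>\<beta> \<noteq> 0\<close> by (simp add: q_def)
    then have "\<forall>\<^sub>F t in nhds \<beta>. loc_eq X (q \<beta>) (q \<beta> + (t - \<beta>) *\<^sub>R d)"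
      using eventually_nhds_compose[OF loc_eq_along_near, where f = "\<lambda>t. (q \<beta>, t - \<beta>)" and a = \<beta>]
      by (simp add: continuous_intros)
    from closure_eventually_witness[OF cl this] obtain t where t: "t \<in> {0..<\<beta>}" "loc_eq X (q \<beta>) (q t)"
      by (auto simp: q_def algebra_simps)
    then have "Str X (q \<beta>) = Str X z" using Str_loc_eq loc by metis
    then show False using psub by blast
  qed
  then have "d \<in> Str X (z + t *\<^sub>R d)" if "t \<in> {0..1}" for t using dX that by (auto simp: q_def)
  from loc_eq_along_line[of "{0..1}" 0 1 d X z, OF _ _ _ this] have "loc_eq X z z'" by (simp add: d_def)
  moreover have "d \<in> Str X z" using dX[of 0] \<open>0 \<in> G\<close> by (simp add: q_def)
  ultimately show ?thesis using leaf_eq by (simp add: d_def)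
qed

text \<open>Leaves of nonsingular points are represented by transversal points on finitely many
  rational hyperplanes, and those are counted by cells. Since only counting matters here, the forms
  in \<open>B\<close> may have real coefficients.\<close>

lemma finite_leaves_of_dim:
  fixes X :: "(real ^ 'n) set"
  assumes fin: "finite {x. singular X x}" and DS: "\<And>S. rational_section X S \<Longrightarrow> definable S"
  shows "finite (leaf X ` {x. dim (Str X x) = k})"
proof (induction k rule: less_induct)
  case (less k)
  have "{x $ i | x i. singular X x} = (\<Union>i. (\<lambda>x. x $ i) ` {x. singular X x})" by auto
  then have "finite {x $ i | x i. singular X x}" using fin by simp
  from separating_rationals[OF this] obtain C where C: "finite C" "C \<subseteq> \<rat>"
    "\<And>K. open K \<Longrightarrow> connected K \<Longrightarrow> K \<noteq> {} \<Longrightarrow> frontier K \<subseteq> {x $ i | x i. singular X x} \<Longrightarrow> \<exists>c\<in>C. c \<in> K"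
    by blast
  define Z where "Z i c = {z. z $ i = c \<and> dim (Str X z) = k \<and> (\<exists>u\<in>Str X z. u $ i \<noteq> 0)}" for i c
  have "leaf X ` {x. dim (Str X x) = k} \<subseteq> leaf X ` {x. singular X x} \<union> (\<Union>i. \<Union>c\<in>C. leaf X ` Z i c)"
  proof (intro image_subsetI, rule ccontr)
    fix x assume "x \<in> {x. dim (Str X x) = k}"
      and "leaf X x \<notin> leaf X ` {x. singular X x} \<union> (\<Union>i. \<Union>c\<in>C. leaf X ` Z i c)"
    then have k: "k = dim (Str X x)" and "\<not> singular X x" and no: "\<And>i c. c \<in> C \<Longrightarrow> leaf X x \<notin> leaf X ` Z i c" by auto
    from nonsingular_reaches_hyperplane[OF C(3) this(2)] obtain z i u where
      z: "z $ i \<in> C" "loc_eq X x z" "z - x \<in> Str X x" "u \<in> Str X x" "u $ i \<noteq> 0" by blast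
    then have "z \<in> Z i (z $ i)" using Str_loc_eq[OF z(2)] k by (auto simp: Z_def)
    then show False using no[OF z(1)] leaf_eq[OF z(2,3)] by blast
  qed
  moreover have "finite (leaf X ` Z i c)" if c: "c \<in> C" for i c
  proof -
    have "definable (X \<inter> {y. y $ i = c})" using DS c C(2) by (auto simp: rational_section_def)
    then obtain A where A: "finite A" "determined A (X \<inter> {y. y $ i = c})"
      using definable_imp_determined by blast
    let ?L = "\<Union>j<k. leaf X ` {x. dim (Str X x) = j}"
    \<comment> \<open>The forms are chosen for the leaf as a set, not for a point, so that finitely
      many leaves contribute finitely many forms.\<close>
    define D where "D P = (SOME D. finite D \<and> (\<forall>y. y \<in> P \<longleftrightarrow> (\<forall>(a, b)\<in>D. a \<bullet> y + b = 0)))"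
      for P :: "(real ^ 'n) set"
    have D: "finite (D (leaf X x)) \<and> (\<forall>y. y \<in> leaf X x \<longleftrightarrow> (\<forall>(a, b)\<in>D (leaf X x). a \<bullet> y + b = 0))" for x
      unfolding D_def by (rule someI_ex[OF leaf_forms])
    define B where "B = \<Union> (D ` ?L)"
    have "finite ?L" using less.IH by simp
    then have "finite B" unfolding B_def by (rule finite_Union[OF finite_imageI]) (use D in auto)
    have B: "\<exists>D\<subseteq>B. \<forall>y. y \<in> leaf X b \<longleftrightarrow> (\<forall>(a, b)\<in>D. a \<bullet> y + b = 0)" if "dim (Str X b) < k" for b
    proof (intro exI conjI)
      show "D (leaf X b) \<subseteq> B" using that by (auto simp: B_def)
      show "\<forall>y. y \<in> leaf X b \<longleftrightarrow> (\<forall>(a, b)\<in>D (leaf X b). a \<bullet> y + b = 0)" using D[of b] by (rule conjunct2)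
    qed
    show ?thesis
    proof (rule finite_image_by_signs)
      show "finite (A \<union> B)" using A(1) \<open>finite B\<close> by simp
      fix z z' assume "z \<in> Z i c" "z' \<in> Z i c" "same_signs (A \<union> B) z z'"
      then show "leaf X z = leaf X z'" using leaf_eq_on_cell[OF A B] by (auto simp: Z_def)
    qed
  qed
  ultimately show ?case using fin C(1) by (meson finite_subset finite_UN_I finite_UnI finite finite_imageI)
qed

lemma finite_leaves:
  fixes X :: "(real ^ 'n) set"
  assumes "finite {x. singular X x}" "\<And>S. rational_section X S \<Longrightarrow> definable S"
  shows "finite (range (leaf X))"
proof (rule finite_subset)
  show "range (leaf X) \<subseteq> (\<Union>k\<le>DIM(real ^ 'n). leaf X ` {x. dim (Str X x) = k})"
    using dim_subset_UNIV by fastforce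
  show "finite \<dots>" using finite_leaves_of_dim[OF assms] by simp
qed

text \<open>At a point \<open>p\<close> of the segment from \<open>x\<close> to \<open>y\<close>
  with \<open>Str X p \<noteq> UNIV\<close>, the forms of its leaf vanish at \<open>p\<close>, hence
  on the whole cell. So \<open>x\<close> and \<open>y\<close> lie on the leaf of \<open>p\<close>
  and \<open>y - x\<close> is a stratum at \<open>p\<close>; the local type is therefore constant
  along the segment.\<close>

lemma determined_by_leaf_forms:
  assumes A: "\<And>x. Str X x \<noteq> UNIV \<Longrightarrow> \<exists>D\<subseteq>A. \<forall>y. y \<in> leaf X x \<longleftrightarrow> (\<forall>(a, b)\<in>D. a \<bullet> y + b = 0)"
  shows "determined A X"
  unfolding determined_def
proof (intro allI impI)
  fix x y assume xy: "same_signs A x y" "x \<in> X"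
  have "y - x \<in> Str X (x + t *\<^sub>R (y - x))" if t: "t \<in> {0..1}" for t
  proof (cases "Str X (x + t *\<^sub>R (y - x)) = UNIV")
    case False
    let ?p = "x + t *\<^sub>R (y - x)"
    obtain D where D: "D \<subseteq> A" "\<And>y. y \<in> leaf X ?p \<longleftrightarrow> (\<forall>(a, b)\<in>D. a \<bullet> y + b = 0)"
      using A[OF False] by blast
    have "a \<bullet> x + b = 0" "a \<bullet> y + b = 0" if "(a, b) \<in> D" for a b
    proof -
      have "a \<bullet> ?p + b = 0" using D(2)[of ?p] that by auto
      moreover have "same_signs A x ?p" using same_signs_segment[OF xy(1), of t] t by simp
      then have "sgn (a \<bullet> x + b) = sgn (a \<bullet> ?p + b)" "sgn (a \<bullet> x + b) = sgn (a \<bullet> y + b)"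
        using xy(1) that D(1) unfolding same_signs_iff by blast+
      ultimately show "a \<bullet> x + b = 0" "a \<bullet> y + b = 0" by (simp_all add: sgn_zero_iff)
    qed
    then have "x - ?p \<in> Str X ?p" "y - ?p \<in> Str X ?p" using D(2)[of x] D(2)[of y] by (auto simp: leaf_def)
    from subspace_diff[OF subspace_Str this(2,1)] show ?thesis by simp
  qed auto
  from loc_eq_along_line[of "{0..1}" 0 1 "y - x" X x, OF _ _ _ this] have "loc_eq X x y" by simp
  then show "y \<in> X" using loc_eq_imp_mem_iff xy(2) by blast
qed

theorem theorem4p3:
  fixes X :: "(real ^ 'n) set"
  shows "definable X \<longleftrightarrow>
    finite {x. singular X x} \<and>
    (\<forall>S. rational_section X S \<longrightarrow> definable S) \<and>
    (\<forall>x. singular X x \<longrightarrow> (\<forall>i. x $ i \<in> \<rat>))"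
proof
  assume "definable X"
  then show "finite {x. singular X x} \<and> (\<forall>S. rational_section X S \<longrightarrow> definable S) \<and>
      (\<forall>x. singular X x \<longrightarrow> (\<forall>i. x $ i \<in> \<rat>))"
    using definable_singular definable_rational_section unfolding rat_vec_def by blast
next
  assume "finite {x. singular X x} \<and> (\<forall>S. rational_section X S \<longrightarrow> definable S) \<and>
      (\<forall>x. singular X x \<longrightarrow> (\<forall>i. x $ i \<in> \<rat>))"
  then have FSP: "finite {x. singular X x}" and DS: "\<And>S. rational_section X S \<Longrightarrow> definable S"
    and RSP: "\<And>x. singular X x \<Longrightarrow> rat_vec x" by (auto simp: rat_vec_def)
  \<comment> \<open>RSP settles the singular points. Elsewhere only sections with strata properly
    inside \<open>Str X x\<close> matter, and DS makes these sections definable.\<close>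
  have rational: "rational_leaf X x" if "Str X x \<noteq> UNIV" for x
  proof (cases "singular X x")
    case True
    then show ?thesis using RSP by (simp add: rational_leaf_singular)
  next
    case False
    show ?thesis
    proof (rule rational_leaf_from_sections[OF _ _ that])
      show "rational_leaf (X \<inter> {y. y $ i = c}) y"
        if "c \<in> \<rat>" "Str (X \<inter> {y. y $ i = c}) y \<subset> Str X x" for i c y
        using that DS by (intro rational_leaf_definable) (auto simp: rational_section_def)
    qed (use False in \<open>simp add: singular_def\<close>)
  qed
  define D where "D P = (SOME D. finite D \<and> rational_forms D \<and> (\<forall>y. y \<in> P \<longleftrightarrow> (\<forall>(a, b)\<in>D. a \<bullet> y + b = 0)))"
    for P :: "(real ^ 'n) set"
  have D: "finite (D (leaf X x)) \<and> rational_forms (D (leaf X x)) \<and>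
      (\<forall>y. y \<in> leaf X x \<longleftrightarrow> (\<forall>(a, b)\<in>D (leaf X x). a \<bullet> y + b = 0))" if "Str X x \<noteq> UNIV" for x
    unfolding D_def by (rule someI_ex[OF rational_leaf_forms[OF rational[OF that]]])
  \<comment> \<open>Points with \<open>Str X x = UNIV\<close> have the whole space as leaf and
    contribute no form.\<close>
  define A where "A = \<Union> (D ` leaf X ` {x. Str X x \<noteq> UNIV})"
  have "finite (leaf X ` {x. Str X x \<noteq> UNIV})"
    using finite_leaves[OF FSP DS] by (rule finite_subset[rotated]) auto
  then have "finite A" unfolding A_def by (rule finite_Union[OF finite_imageI]) (use D in auto)
  moreover have "rational_forms A" using D by (fastforce simp: A_def rational_forms_def)
  moreover have "determined A X"
  proof (rule determined_by_leaf_forms)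
    show "\<exists>D\<subseteq>A. \<forall>y. y \<in> leaf X x \<longleftrightarrow> (\<forall>(a, b)\<in>D. a \<bullet> y + b = 0)" if "Str X x \<noteq> UNIV" for x
    proof (intro exI conjI)
      show "D (leaf X x) \<subseteq> A" using that by (auto simp: A_def)
      show "\<forall>y. y \<in> leaf X x \<longleftrightarrow> (\<forall>(a, b)\<in>D (leaf X x). a \<bullet> y + b = 0)"
        using D[OF that] by (elim conjE)
    qed
  qed
  ultimately show "definable X" by (rule determined_imp_definable)
qed

end
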